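(* Let $A$ be an $m\times(n+1)$ integer matrix all of whose column sums are equal, with homogeneous toric ideal $I_A\subset\mathbb{C}[p_0,\dots,p_n]$, and let $\mathcal{M}=V(I_A)\subseteq\mathbb{P}^n_p$ be the toric model defined by $A$. Let \[ M=\begin{pmatrix} u_0 & p_0\\ \vdots & \vdots\\ u_n & p_n\end{pmatrix}, \] a matrix with entries in $\mathbb{C}[p_0,\dots,p_n,u_0,\dots,u_n]$, and let $p_+=p_0+p_1+\cdots+p_n$. Then the ideal \[ \bigl(I_A+I_2(AM)\bigr):\langle p_0p_1\cdots p_n\,p_+\rangle^{\infty} \] of $\mathbb{C}[p_0,\dots,p_n,u_0,\dots,u_n]$ is the likelihood ideal of $\mathcal{M}$.
   Context: $\mathbb{P}^n_p$ and $\mathbb{P}^n_u$ are two copies of complex projective $n$-space with homogeneous coordinates $p_0,\dots,p_n$ and $u_0,\dots,u_n$; the coordinate ring of $\mathbb{P}^n_p\times\mathbb{P}^n_u$ is the bigraded ring $\mathbb{C}[p_0,\dots,p_n,u_0,\dots,u_n]$. Write $p_+=\sum_i p_i$ and $u_+=\sum_i u_i$. $I_k(N)$ denotes the ideal generated by the $k\times k$ minors of a matrix $N$, and $J:K^\infty$ denotes saturation. Ideals generated by polynomials in the $p_i$ alone, such as $I_A$, are extended to the big ring when needed. Toric model: for an $m\times(n+1)$ integer matrix $A$ with all column sums equal, the toric ideal $I_A$ is generated by all binomials $p^v-p^w$ with $v,w\in\mathbb{N}^{n+1}$ and $Av=Aw$, where $p^v=p_0^{v_0}\cdots p_n^{v_n}$.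 The toric model $\mathcal{M}=V(I_A)\subseteq\mathbb{P}^n_p$ is the closure of the image of $(\mathbb{C}^* )^m\to\mathbb{P}^n_p$, $\theta\mapsto[\theta^{A_0}:\cdots:\theta^{A_n}]$, where $A_i$ is the $i$-th column of $A$. Likelihood correspondence and likelihood ideal: the likelihood function is \[ \ell_u(p)=\frac{p_0^{u_0}\cdots p_n^{u_n}}{(p_0+\cdots+p_n)^{u_0+\cdots+u_n}}, \] and $\operatorname{dlog}\ell_u(p)=\sum_{i=0}^n\left(\frac{u_i}{p_i}-\frac{u_+}{p_+}\right)dp_i$. Let $\mathcal{H}\subset\mathbb{P}^n_p$ be the union of the $n+2$ hyperplanes $V(p_0),\dots,V(p_n),V(p_+)$. For a closed irreducible subvariety $\mathcal{M}\subseteq\mathbb{P}^n_p$ with smooth locus $\mathcal{M}_{\mathrm{reg}}$, the likelihood correspondence is the Zariski closure \[ \mathcal{L}_{\mathcal{M}}=\overline{\{(p,u)\in(\mathcal{M}_{\mathrm{reg}}\setminus\mathcal{H})\times\mathbb{P}^n_u : \operatorname{dlog}\ell_u|_{\mathcal{M}}(p)=0\}}\subseteq\mathbb{P}^n_p\times\mathbb{P}^n_u, \] where $\operatorname{dlog}\ell_u|_{\mathcal{M}}(p)=0$ means that the one-form $\sum_{i=0}^n\left(\frac{u_i}{p_i}-\frac{u_+}{p_+}\right)dp_i$ vanishes on the tangent space of $\mathcal{M}$ at $p$ (equivalently, on the tangent space of the affine cone over $\mathcal{M}$ at a representative of $p$). The likelihood ideal of $\mathcal{M}$ is the (bihomogeneous)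 vanishing ideal of $\mathcal{L}_{\mathcal{M}}$ in $\mathbb{C}[p_0,\dots,p_n,u_0,\dots,u_n]$. *)

theory Defs
  imports "HOL-Analysis.Analysis" "HOL-Library.Poly_Mapping"
begin

section \<open>Polynomials\<close>

text \<open>Polynomials with complex coefficients in the variables indexed by \<^typ>\<open>'v\<close>:
  a monomial is a finitely supported exponent vector, and multiplication is the convolution
  product of \<^typ>\<open>'a \<Rightarrow>\<^sub>0 'b\<close>.\<close>

type_synonym 'v cpoly = "('v \<Rightarrow>\<^sub>0 nat) \<Rightarrow>\<^sub>0 complex"

definition Const :: "complex \<Rightarrow> 'v cpoly" where
  "Const c = Poly_Mapping.single 0 c"

definition monomial :: "('v \<Rightarrow>\<^sub>0 nat) \<Rightarrow> 'v cpoly" where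
  "monomial v = Poly_Mapping.single v 1"

definition Var :: "'v \<Rightarrow> 'v cpoly" where
  "Var i = monomial (Poly_Mapping.single i 1)"

text \<open>Substitution of elements \<open>x i\<close> of a commutative ring for the variables, the coefficients
  being mapped by \<open>\<phi>\<close>. It is used for evaluation at a point and for the inclusion
  \<open>\<complex>[p] \<subseteq> \<complex>[p, u]\<close>.\<close>

definition poly_subst :: "(complex \<Rightarrow> 'r::comm_ring_1) \<Rightarrow> ('v \<Rightarrow> 'r) \<Rightarrow> 'v cpoly \<Rightarrow> 'r" where
  "poly_subst \<phi> x f =
     (\<Sum>m\<in>Poly_Mapping.keys f. \<phi> (Poly_Mapping.lookup f m) *
        (\<Prod>i\<in>Poly_Mapping.keys m. x i ^ Poly_Mapping.lookup m i))"

definition eval :: "('v \<Rightarrow> complex) \<Rightarrow> 'v cpoly \<Rightarrow> complex" where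
  "eval x f = poly_subst (\<lambda>c. c) x f"

definition pdiff :: "'v \<Rightarrow> 'v cpoly \<Rightarrow> 'v cpoly" where
  "pdiff i f =
     (\<Sum>m\<in>Poly_Mapping.keys f. Poly_Mapping.single (m - Poly_Mapping.single i 1)
        (of_nat (Poly_Mapping.lookup m i) * Poly_Mapping.lookup f m))"

definition homogeneous :: "nat \<Rightarrow> 'v::finite cpoly \<Rightarrow> bool" where
  "homogeneous d f \<longleftrightarrow> (\<forall>m\<in>Poly_Mapping.keys f. (\<Sum>i\<in>UNIV. Poly_Mapping.lookup m i) = d)"

text \<open>The coordinate ring of \<open>\<P>\<^sup>n\<^sub>p \<times> \<P>\<^sup>n\<^sub>u\<close> is \<^typ>\<open>('n + 'n) cpoly\<close>, where
  \<open>n + 1 = CARD('n)\<close>: the variable \<open>p\<^sub>i\<close> has index \<open>Inl i\<close> and \<open>u\<^sub>i\<close> has index \<open>Inr i\<close>.\<close>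

definition bihomogeneous :: "nat \<Rightarrow> nat \<Rightarrow> ('n::finite + 'n) cpoly \<Rightarrow> bool" where
  "bihomogeneous d e f \<longleftrightarrow>
     (\<forall>m\<in>Poly_Mapping.keys f. (\<Sum>i\<in>UNIV. Poly_Mapping.lookup m (Inl i)) = d \<and>
                              (\<Sum>i\<in>UNIV. Poly_Mapping.lookup m (Inr i)) = e)"

definition pvar :: "'n \<Rightarrow> ('n + 'n) cpoly" where "pvar i = Var (Inl i)"
definition uvar :: "'n \<Rightarrow> ('n + 'n) cpoly" where "uvar i = Var (Inr i)"

definition incl_p :: "'n cpoly \<Rightarrow> ('n + 'n) cpoly" where
  "incl_p f = poly_subst Const pvar f"


section \<open>Ideals\<close>

text \<open>Ideals of a commutative ring are its submodules over itself.\<close>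

definition ideal_gen :: "'r::comm_ring_1 set \<Rightarrow> 'r set" where
  "ideal_gen S = module.span (*) S"

definition ideal_sum :: "'r::comm_ring_1 set \<Rightarrow> 'r set \<Rightarrow> 'r set" where
  "ideal_sum I J = {a + b | a b. a \<in> I \<and> b \<in> J}"

definition ideal_pow :: "'r::comm_ring_1 set \<Rightarrow> nat \<Rightarrow> 'r set" where
  "ideal_pow K N = ideal_gen {\<Prod>i<N. g i | g. \<forall>i<N. g i \<in> K}"

definition colon :: "'r::comm_ring_1 set \<Rightarrow> 'r set \<Rightarrow> 'r set" where
  "colon J K = {f. \<forall>g\<in>K. f * g \<in> J}"

definition saturation :: "'r::comm_ring_1 set \<Rightarrow> 'r set \<Rightarrow> 'r set" where
  "saturation J K = (\<Union>N. colon J (ideal_pow K N))"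

definition homogeneous_ideal :: "'v::finite cpoly set \<Rightarrow> bool" where
  "homogeneous_ideal I \<longleftrightarrow> (\<exists>S. (\<forall>f\<in>S. \<exists>d. homogeneous d f) \<and> I = ideal_gen S)"

text \<open>The ideal of the \<open>k \<times> k\<close> minors, with \<open>k = CARD('k)\<close>. Rows and columns are selected by
  arbitrary injections rather than by increasing ones, so every minor appears with both signs.\<close>

definition minors_ideal :: "'k::finite itself \<Rightarrow> 'r::comm_ring_1^'c^'m \<Rightarrow> 'r set" where
  "minors_ideal _ N =
     ideal_gen {det ((\<chi> a b. N $ r a $ c b) :: 'r^'k^'k) | r c. inj r \<and> inj c}"


section \<open>Projective space and the Zariski topology\<close>

definition proj_rel :: "complex^'n \<Rightarrow> complex^'n \<Rightarrow> bool" where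
  "proj_rel x y \<longleftrightarrow> x \<noteq> 0 \<and> (\<exists>c. c \<noteq> 0 \<and> y = c *s x)"

lemma part_equivp_proj_rel: "part_equivp (proj_rel :: complex^'n \<Rightarrow> _)"
proof (rule part_equivpI)
  show "\<exists>x. proj_rel x (x :: complex^'n)"
    by (rule exI[of _ "1"]) (auto simp: proj_rel_def vec_eq_iff intro!: exI[of _ 1])
  show "symp (proj_rel :: complex^'n \<Rightarrow> _)"
  proof (rule sympI)
    fix x y :: "complex^'n"
    assume "proj_rel x y"
    then obtain c where c: "x \<noteq> 0" "c \<noteq> 0" "y = c *s x"
      by (auto simp: proj_rel_def)
    then have "x = inverse c *s y" "inverse c \<noteq> 0"
      by auto
    moreover have "y \<noteq> 0"
      using c by auto
    ultimately show "proj_rel y x"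
      by (auto simp: proj_rel_def)
  qed
  show "transp (proj_rel :: complex^'n \<Rightarrow> _)"
  proof (rule transpI)
    fix x y z :: "complex^'n"
    assume "proj_rel x y" "proj_rel y z"
    then obtain c d where "x \<noteq> 0" "c \<noteq> 0" "y = c *s x" "d \<noteq> 0" "z = d *s y"
      by (auto simp: proj_rel_def)
    then show "proj_rel x z"
      by (auto simp: proj_rel_def intro!: exI[of _ "d * c"])
  qed
qed

text \<open>\<open>'n proj\<close> is the projective space of dimension \<open>CARD('n) - 1\<close>. The term
  \<open>proj_class x\<close> is the point with homogeneous coordinates \<open>x\<close>; it is only meaningful
  for \<open>x \<noteq> 0\<close>.\<close>

quotient_type 'n proj = "complex^'n" / partial: proj_rel
  morphisms rep_proj proj_class
  by (rule part_equivp_proj_rel)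

definition coords :: "'n::finite proj \<Rightarrow> (complex^'n) set" where
  "coords X = {x. x \<noteq> 0 \<and> proj_class x = X}"

text \<open>A polynomial vanishes at a point of (a product of) projective spaces if it vanishes at all
  of its homogeneous coordinate vectors.\<close>

definition vanishes :: "'n::finite cpoly \<Rightarrow> 'n proj \<Rightarrow> bool" where
  "vanishes f X \<longleftrightarrow> (\<forall>x\<in>coords X. eval (\<lambda>i. x $ i) f = 0)"

definition eval2 :: "complex^'n \<Rightarrow> complex^'n \<Rightarrow> ('n::finite + 'n) cpoly \<Rightarrow> complex" where
  "eval2 x y f = eval (case_sum (\<lambda>i. x $ i) (\<lambda>i. y $ i)) f"

definition vanishes2 :: "('n::finite + 'n) cpoly \<Rightarrow> 'n proj \<times> 'n proj \<Rightarrow> bool" where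
  "vanishes2 f XY \<longleftrightarrow> (\<forall>x\<in>coords (fst XY). \<forall>y\<in>coords (snd XY). eval2 x y f = 0)"

definition zero_locus :: "'n::finite cpoly set \<Rightarrow> 'n proj set" where
  "zero_locus F = {X. \<forall>f\<in>F. vanishes f X}"

definition zero_locus2 :: "('n::finite + 'n) cpoly set \<Rightarrow> ('n proj \<times> 'n proj) set" where
  "zero_locus2 F = {XY. \<forall>f\<in>F. vanishes2 f XY}"

text \<open>Since \<open>vanishes\<close> refers to all coordinate vectors, these are the usual (bi)homogeneous
  vanishing ideals.\<close>

definition vanishing_ideal :: "'n::finite proj set \<Rightarrow> 'n cpoly set" where
  "vanishing_ideal Z = {f. \<forall>X\<in>Z. vanishes f X}"

definition vanishing_ideal2 :: "('n::finite proj \<times> 'n proj) set \<Rightarrow> ('n + 'n) cpoly set" where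
  "vanishing_ideal2 Z = {f. \<forall>XY\<in>Z. vanishes2 f XY}"

definition zariski_closed :: "'n::finite proj set \<Rightarrow> bool" where
  "zariski_closed Z \<longleftrightarrow> (\<exists>F. (\<forall>f\<in>F. \<exists>d. homogeneous d f) \<and> Z = zero_locus F)"

definition zariski_closed2 :: "('n::finite proj \<times> 'n proj) set \<Rightarrow> bool" where
  "zariski_closed2 Z \<longleftrightarrow> (\<exists>F. (\<forall>f\<in>F. \<exists>d e. bihomogeneous d e f) \<and> Z = zero_locus2 F)"

definition zariski_irreducible :: "'n::finite proj set \<Rightarrow> bool" where
  "zariski_irreducible Z \<longleftrightarrow> Z \<noteq> {} \<and>
     (\<forall>Z1 Z2. zariski_closed Z1 \<longrightarrow> zariski_closed Z2 \<longrightarrow> Z \<subseteq> Z1 \<union> Z2 \<longrightarrow> Z \<subseteq> Z1 \<or> Z \<subseteq> Z2)"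

text \<open>Krull dimension of a closed subset: the supremum of the lengths \<open>k\<close> of strict chains
  \<open>C 0 \<subset> \<dots> \<subset> C k\<close> of irreducible closed subsets.\<close>

definition zariski_dim :: "'n::finite proj set \<Rightarrow> enat" where
  "zariski_dim Z = Sup {enat k | k. \<exists>C :: nat \<Rightarrow> 'n proj set.
     (\<forall>i\<le>k. zariski_closed (C i) \<and> zariski_irreducible (C i) \<and> C i \<subseteq> Z) \<and>
     (\<forall>i<k. C i \<subset> C (Suc i))}"


section \<open>Tangent spaces and the smooth locus\<close>

text \<open>The Zariski tangent space at \<open>x\<close> of the affine cone over \<open>Z\<close>.\<close>

definition cone_tangent :: "'n::finite proj set \<Rightarrow> complex^'n \<Rightarrow> (complex^'n) set" where
  "cone_tangent Z x =
     {t. \<forall>f\<in>vanishing_ideal Z. (\<Sum>i\<in>UNIV. eval (\<lambda>j. x $ j) (pdiff i f) * t $ i) = 0}"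

text \<open>The smooth locus of an irreducible closed \<open>Z\<close>, by the Jacobian criterion; the affine cone
  has dimension one more than \<open>Z\<close>.\<close>

definition smooth_locus :: "'n::finite proj set \<Rightarrow> 'n proj set" where
  "smooth_locus Z =
     {X\<in>Z. \<forall>x\<in>coords X. enat (vec.dim (cone_tangent Z x)) = zariski_dim Z + 1}"


section \<open>Toric models and the likelihood correspondence\<close>

definition expo :: "('n::finite \<Rightarrow>\<^sub>0 nat) \<Rightarrow> int^'n" where
  "expo v = (\<chi> i. int (Poly_Mapping.lookup v i))"

definition toric_ideal :: "int^'n^'m \<Rightarrow> 'n::finite cpoly set" where
  "toric_ideal A = ideal_gen {monomial v - monomial w | v w. A *v expo v = A *v expo w}"

definition toric_model :: "int^'n^'m \<Rightarrow> 'n::finite proj set" where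
  "toric_model A = zero_locus (toric_ideal A)"

definition hyperplanes :: "'n::finite proj set" where
  "hyperplanes = (\<Union>i. zero_locus {Var i}) \<union> zero_locus {\<Sum>i\<in>UNIV. Var i}"

text \<open>The one-form \<open>dlog \<ell>\<^sub>u\<close> at \<open>p\<close>, evaluated at a tangent vector \<open>t\<close>.\<close>

definition dlog_lik :: "complex^'n::finite \<Rightarrow> complex^'n \<Rightarrow> complex^'n \<Rightarrow> complex" where
  "dlog_lik u p t =
     (\<Sum>i\<in>UNIV. (u $ i / p $ i - (\<Sum>j\<in>UNIV. u $ j) / (\<Sum>j\<in>UNIV. p $ j)) * t $ i)"

definition likelihood_correspondence :: "'n::finite proj set \<Rightarrow> ('n proj \<times> 'n proj) set" where
  "likelihood_correspondence Z = zariski_closed2 hull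
     {(proj_class p, proj_class u) | p u.
        p \<noteq> 0 \<and> u \<noteq> 0 \<and> proj_class p \<in> smooth_locus Z - hyperplanes \<and>
        (\<forall>t\<in>cone_tangent Z p. dlog_lik u p t = 0)}"

definition likelihood_ideal :: "'n::finite proj set \<Rightarrow> ('n + 'n) cpoly set" where
  "likelihood_ideal Z = vanishing_ideal2 (likelihood_correspondence Z)"

definition matrix_M :: "('n::finite + 'n) cpoly^2^'n" where
  "matrix_M = (\<chi> i. vector [uvar i, pvar i])"

definition matrix_AM :: "int^'n^'m \<Rightarrow> ('n::finite + 'n) cpoly^2^'m" where
  "matrix_AM A = (\<chi> i j. of_int (A $ i $ j)) ** matrix_M"

text \<open>If the common column sum of \<open>A\<close> is nonzero then \<open>toric_ideal A\<close> is homogeneous, so that in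
  this case homogeneity is not an extra assumption. For common column sum 0 it may fail.\<close>

lemma toric_ideal_homogeneous:
  fixes A :: "int^'n::finite^'m::finite"
  assumes s: "\<And>j. (\<Sum>i\<in>UNIV. A $ i $ j) = s" and "s \<noteq> 0"
  shows "homogeneous_ideal (toric_ideal A)"
proof -
  have deg: "(\<Sum>i\<in>UNIV. (A *v expo v) $ i) = s * int (\<Sum>j\<in>UNIV. Poly_Mapping.lookup v j)" for v
  proof -
    have "(\<Sum>i\<in>UNIV. (A *v expo v) $ i) =
        (\<Sum>i\<in>UNIV. \<Sum>j\<in>UNIV. A $ i $ j * int (Poly_Mapping.lookup v j))"
      by (simp add: matrix_vector_mult_def expo_def)
    also have "\<dots> = (\<Sum>j\<in>UNIV. (\<Sum>i\<in>UNIV. A $ i $ j) * int (Poly_Mapping.lookup v j))"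
      by (subst sum.swap) (simp add: sum_distrib_right)
    finally show ?thesis
      by (simp add: s sum_distrib_left)
  qed
  have "\<exists>d. homogeneous d (monomial v - monomial w)" if "A *v expo v = A *v expo w" for v w
  proof -
    have eq: "(\<Sum>j\<in>UNIV. Poly_Mapping.lookup v j) = (\<Sum>j\<in>UNIV. Poly_Mapping.lookup w j)"
      using deg[of v] deg[of w] that \<open>s \<noteq> 0\<close> by (metis mult_left_cancel of_nat_eq_iff)
    have "Poly_Mapping.keys (monomial v - monomial w) \<subseteq> {v, w}"
      using keys_diff[of "monomial v" "monomial w"] by (auto simp: monomial_def split: if_splits)
    then show ?thesis
      using eq unfolding homogeneous_def by (metis insertE singletonD subsetD)
  qed
  then show ?thesis
    unfolding homogeneous_ideal_def toric_ideal_def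
    by (intro exI[of _ "{monomial v - monomial w | v w. A *v expo v = A *v expo w}"]) auto
qed

end

theory Submission
  imports Defs "HOL-Complex_Analysis.Conformal_Mappings"
begin

text \<open>On the torus, the tangent space of the affine cone over \<open>\<M>\<close> at \<open>p\<close> is \<open>p \<cdot> V\<close>, where \<open>V\<close> is the
  complex row space of \<open>A\<close>, so \<open>dlog \<ell>\<^sub>u\<close> vanishes there iff \<open>A u = (u\<^sub>+ / p\<^sub>+) A p\<close>. Homogeneity of
  \<open>I\<^sub>A\<close> puts the all-ones vector into \<open>V\<close>; hence for \<open>p\<^sub>+ \<noteq> 0\<close> this is the rank condition on \<open>A M\<close>.

  Conversely, modulo the minors \<open>u\<close> may be replaced, up to a power of \<open>p\<^sub>+\<close>, by a linear function of \<open>u\<close>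
  that solves these equations for every \<open>u\<close>. If \<open>f\<close> is in the likelihood ideal, the substituted
  polynomial times \<open>p\<^sub>+\<close> therefore vanishes on the whole torus of \<open>\<M>\<close> times \<open>\<complex>\<^sup>n\<^sup>+\<^sup>1\<close>, and by linear
  independence of characters it lies in the extension of \<open>I\<^sub>A\<close>.

  That all torus points of \<open>\<M>\<close> are smooth amounts to \<open>dim \<M> = dim V - 1\<close>. A chain of that length is
  obtained by successively equating coordinates of \<open>V\<close>. A longer chain would give too many
  algebraically independent forms on \<open>\<M>\<close>, because the number of values \<open>A v\<close> with \<open>|v| \<le> E\<close> is
  \<open>O(E\<^bsup>dim V\<^esup>)\<close>.\<close>
section \<open>Evaluation of polynomials\<close>

abbreviation "lookup \<equiv> Poly_Mapping.lookup"
abbreviation "keys \<equiv> Poly_Mapping.keys"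

definition mon_at :: "('v::finite \<Rightarrow> 'a::comm_semiring_1) \<Rightarrow> ('v \<Rightarrow>\<^sub>0 nat) \<Rightarrow> 'a" where
  "mon_at x m = (\<Prod>i\<in>UNIV. x i ^ lookup m i)"

lemma mon_at_0 [simp]: "mon_at x 0 = 1"
  by (simp add: mon_at_def)

lemma mon_at_add: "mon_at x (m + m') = mon_at x m * mon_at x m'"
  by (simp add: mon_at_def lookup_add power_add prod.distrib)

lemma mon_at_single [simp]: "mon_at x (Poly_Mapping.single i k) = x i ^ k"
proof -
  have "x j ^ lookup (Poly_Mapping.single i k) j = (if j = i then x i ^ k else 1)" for j
    by (auto simp: lookup_single when_def)
  then show ?thesis
    by (simp add: mon_at_def)
qed

lemma mon_at_mult: "mon_at (\<lambda>i. x i * y i) m = mon_at x m * mon_at y m"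
  by (simp add: mon_at_def power_mult_distrib prod.distrib)

lemma mon_at_keys: "(\<Prod>i\<in>keys m. x i ^ lookup m i) = mon_at x m"
  unfolding mon_at_def by (rule prod.mono_neutral_left) (auto simp: in_keys_iff)

lemma mon_at_nonzero: "(\<And>i. x i \<noteq> (0::complex)) \<Longrightarrow> mon_at x m \<noteq> 0"
  by (simp add: mon_at_def)

lemma mon_at_exp: "mon_at (\<lambda>i. exp (z i :: complex)) m = exp (\<Sum>i\<in>UNIV. of_nat (lookup m i) * z i)"
  by (simp add: mon_at_def exp_sum exp_of_nat_mult)

lemma poly_subst_superset:
  assumes "finite S" "keys f \<subseteq> S" "\<phi> 0 = 0"
  shows "poly_subst \<phi> x f = (\<Sum>m\<in>S. \<phi> (lookup f m) * mon_at x m)"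
  unfolding poly_subst_def mon_at_keys
  using assms by (intro sum.mono_neutral_left) (auto simp: in_keys_iff)

context
  fixes x :: "'v::finite \<Rightarrow> complex"
begin

lemma eval_eq_sum: "eval x f = (\<Sum>m\<in>keys f. lookup f m * mon_at x m)"
  unfolding eval_def by (rule poly_subst_superset) auto

lemma eval_superset:
  "finite S \<Longrightarrow> keys f \<subseteq> S \<Longrightarrow> eval x f = (\<Sum>m\<in>S. lookup f m * mon_at x m)"
  unfolding eval_def by (rule poly_subst_superset) auto

lemma eval_0 [simp]: "eval x 0 = 0"
  by (simp add: eval_eq_sum)

lemma eval_single: "eval x (Poly_Mapping.single m c) = c * mon_at x m"
  by (simp add: eval_superset[of "{m}"])

lemma eval_monomial [simp]: "eval x (monomial m) = mon_at x m"
  by (simp add: monomial_def eval_single)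

lemma eval_Const [simp]: "eval x (Const c) = c"
  by (simp add: Const_def eval_single)

lemma eval_Var [simp]: "eval x (Var i) = x i"
  by (simp add: Var_def)

lemma eval_1 [simp]: "eval x 1 = 1"
  using eval_single[of 0 1] by simp

lemma eval_add [simp]: "eval x (f + g) = eval x f + eval x g"
proof -
  have *: "keys (f + g) \<subseteq> keys f \<union> keys g"
    by (rule keys_add)
  show ?thesis
    by (simp add: eval_superset[OF _ *] eval_superset[of "keys f \<union> keys g"] lookup_add
        distrib_right sum.distrib)
qed

lemma eval_uminus [simp]: "eval x (- f) = - eval x f"
  using eval_add[of f "- f"] by (simp add: eq_neg_iff_add_eq_0 add.commute)

lemma eval_diff [simp]: "eval x (f - g) = eval x f - eval x g"
  using eval_add[of f "- g"] by simp

lemma eval_sum [simp]: "eval x (\<Sum>i\<in>I. f i) = (\<Sum>i\<in>I. eval x (f i))"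
  by (induction I rule: infinite_finite_induct) auto

lemma sum_single_lookup: "(\<Sum>m\<in>keys f. Poly_Mapping.single m (lookup f m)) = f"
  by (rule poly_mapping_eqI) (auto simp: lookup_sum lookup_single when_def in_keys_iff)

lemma eval_mult [simp]: "eval x (f * g) = eval x f * eval x g"
proof -
  have "f * g = (\<Sum>m\<in>keys f. Poly_Mapping.single m (lookup f m)) *
                (\<Sum>m\<in>keys g. Poly_Mapping.single m (lookup g m))"
    by (simp add: sum_single_lookup)
  also have "\<dots> = (\<Sum>m\<in>keys f. \<Sum>n\<in>keys g.
      Poly_Mapping.single (m + n) (lookup f m * lookup g n))"
    by (simp add: sum_product mult_single)
  finally show ?thesis
    by (simp add: eval_single mon_at_add eval_eq_sum[of f] eval_eq_sum[of g] sum_product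
        mult_ac)
qed

lemma eval_power [simp]: "eval x (f ^ k) = eval x f ^ k"
  by (induction k) auto

lemma eval_prod [simp]: "eval x (\<Prod>i\<in>I. f i) = (\<Prod>i\<in>I. eval x (f i))"
  by (induction I rule: infinite_finite_induct) auto

lemma eval_of_nat [simp]: "eval x (of_nat k) = of_nat k"
  by (induction k) auto

lemma eval_of_int [simp]: "eval x (of_int k) = of_int k"
  by (cases k) auto

lemma eval_mon_at [simp]: "eval x (mon_at f m) = mon_at (\<lambda>i. eval x (f i)) m"
  by (simp add: mon_at_def)

end

lemma Const_mult: "Const (a * b) = Const a * Const b"
  by (simp add: Const_def mult_single)

lemma Const_of_int: "Const (of_int a) = of_int a"
  by (simp add: Const_def)

lemma Const_1 [simp]: "Const 1 = 1"
  by (simp add: Const_def)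

lemma monomial_eq_mon_at: "monomial m = mon_at Var (m :: 'v::finite \<Rightarrow>\<^sub>0 nat)"
proof -
  have *: "finite I \<Longrightarrow> (\<Prod>i\<in>I. Var i ^ g i) = monomial (\<Sum>i\<in>I. Poly_Mapping.single i (g i))"
    for I and g :: "_ \<Rightarrow> nat"
  proof (induction I rule: finite_induct)
    case (insert i I)
    have "Var i ^ k = monomial (Poly_Mapping.single i k)" for k
      by (induction k) (auto simp: Var_def monomial_def mult_single simp flip: single_add)
    then show ?case
      using insert by (simp add: monomial_def mult_single)
  qed (simp add: monomial_def)
  have "(\<Sum>i\<in>UNIV. Poly_Mapping.single i (lookup m i)) = m"
    by (rule poly_mapping_eqI) (auto simp: lookup_sum lookup_single when_def)
  then show ?thesis
    by (simp add: mon_at_def *)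
qed

lemma poly_eq_sum_Const: "(f :: 'v::finite cpoly) = (\<Sum>m\<in>keys f. Const (lookup f m) * mon_at Var m)"
  by (subst sum_single_lookup[of f, symmetric])
     (simp add: Const_def monomial_def mult_single flip: monomial_eq_mon_at)

lemma eval_continuous_on:
  fixes x :: "'t::topological_space \<Rightarrow> 'v::finite \<Rightarrow> complex"
  assumes "\<And>i. continuous_on S (\<lambda>t. x t i)"
  shows "continuous_on S (\<lambda>t. eval (x t) f)"
  unfolding eval_eq_sum mon_at_def by (intro continuous_intros assms)

lemma eval_zero_limit:
  fixes a b :: "'v::finite \<Rightarrow> complex"
  assumes "\<And>c. c \<noteq> 0 \<Longrightarrow> eval (\<lambda>i. a i + c * b i) f = 0"
  shows "eval a f = 0"
proof -
  have "continuous_on UNIV (\<lambda>c. eval (\<lambda>i. a i + c * b i) f)"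
    by (intro eval_continuous_on continuous_intros)
  then have "((\<lambda>c. eval (\<lambda>i. a i + c * b i) f) \<longlongrightarrow> eval (\<lambda>i. a i + 0 * b i) f) (at 0)"
    unfolding continuous_on_def by blast
  moreover have "((\<lambda>c. eval (\<lambda>i. a i + c * b i) f) \<longlongrightarrow> 0) (at 0)"
    by (rule tendsto_eventually) (auto simp: eventually_at_filter assms)
  ultimately show ?thesis
    using tendsto_unique[OF at_neq_bot, of "\<lambda>c. eval (\<lambda>i. a i + c * b i) f" _ 0 0] by simp
qed

section \<open>Graded parts\<close>

definition weight :: "('v::finite \<Rightarrow> nat) \<Rightarrow> ('v \<Rightarrow>\<^sub>0 nat) \<Rightarrow> nat" where
  "weight w m = (\<Sum>i\<in>UNIV. w i * lookup m i)"

definition graded_part :: "('v::finite \<Rightarrow> nat) \<Rightarrow> nat \<Rightarrow> 'v cpoly \<Rightarrow> 'v cpoly" where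
  "graded_part w d f = (\<Sum>m\<in>{m\<in>keys f. weight w m = d}. Poly_Mapping.single m (lookup f m))"

lemma lookup_graded_part: "lookup (graded_part w d f) m = (if weight w m = d then lookup f m else 0)"
  by (auto simp: graded_part_def lookup_sum lookup_single when_def in_keys_iff)

lemma keys_graded_part: "keys (graded_part w d f) = {m\<in>keys f. weight w m = d}"
  by (auto simp: in_keys_iff lookup_graded_part split: if_splits)

lemma mon_at_weighted: "mon_at (\<lambda>i. c ^ w i * x i) m = c ^ weight w m * mon_at x m"
  by (simp add: mon_at_mult) (simp add: mon_at_def weight_def power_sum flip: power_mult)

lemma eval_weighted:
  assumes "finite D" "weight w ` keys f \<subseteq> D"
  shows "eval (\<lambda>i. c ^ w i * x i) f = (\<Sum>d\<in>D. c ^ d * eval x (graded_part w d f))"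
proof -
  have "(\<Sum>d\<in>D. c ^ d * eval x (graded_part w d f)) =
      (\<Sum>d\<in>D. \<Sum>m\<in>{m\<in>keys f. weight w m = d}. c ^ weight w m * (lookup f m * mon_at x m))"
    by (simp add: eval_eq_sum keys_graded_part lookup_graded_part sum_distrib_left)
  also have "\<dots> = (\<Sum>m\<in>keys f. c ^ weight w m * (lookup f m * mon_at x m))"
    by (rule sum.group) (use assms in auto)
  finally show ?thesis
    unfolding eval_eq_sum[of "\<lambda>i. c ^ w i * x i"] mon_at_weighted by (simp add: mult_ac)
qed

lemma powers_independent:
  fixes a :: "nat \<Rightarrow> complex"
  assumes "\<And>c. c \<noteq> 0 \<Longrightarrow> (\<Sum>d\<le>n. a d * c ^ d) = 0" "d \<le> n"
  shows "a d = 0"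
proof -
  have "(\<Sum>d\<le>Suc n. (if d = 0 then 0 else a (d - 1)) * c ^ d) = c * (\<Sum>d\<le>n. a d * c ^ d)" for c
    by (subst sum.atMost_Suc_shift) (simp add: sum_distrib_left mult_ac)
  then have "(\<Sum>d\<le>Suc n. (if d = 0 then 0 else a (d - 1)) * c ^ d) = 0" for c
    using assms(1)[of c] by (cases "c = 0") auto
  then have "\<forall>d\<le>Suc n. (if d = 0 then 0 else a (d - 1)) = 0"
    using polyfun_eq_0[of "\<lambda>d. if d = 0 then 0 else a (d - 1)" "Suc n"] by blast
  then show ?thesis
    using assms(2) by (auto dest: spec[of _ "Suc d"])
qed

lemma eval_graded_part_zero:
  assumes "\<And>c. c \<noteq> 0 \<Longrightarrow> eval (\<lambda>i. c ^ w i * x i) f = 0"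
  shows "eval x (graded_part w d f) = 0"
proof -
  obtain n where n: "weight w ` keys f \<subseteq> {..n}" "d \<le> n"
  proof
    show "weight w ` keys f \<subseteq> {..Max (insert d (weight w ` keys f))}"
      by auto
  qed auto
  have "(\<Sum>d\<le>n. eval x (graded_part w d f) * c ^ d) = 0" if "c \<noteq> 0" for c
    using assms[OF that] eval_weighted[OF _ n(1), of c x] by (simp add: mult.commute)
  then show ?thesis
    using powers_independent[where n = n and d = d and a = "\<lambda>d. eval x (graded_part w d f)"] n by auto
qed

lemma eval_zero_if_graded_parts_zero:
  assumes "\<And>d. eval x (graded_part w d f) = 0"
  shows "eval x f = 0"
  using eval_weighted[of "weight w ` keys f" w f 1 x] assms by simp

lemma homogeneous_iff_weight: "homogeneous d f \<longleftrightarrow> (\<forall>m\<in>keys f. weight (\<lambda>_. 1) m = d)"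
  by (simp add: homogeneous_def weight_def)

lemma eval_homogeneous_scale:
  assumes "homogeneous d f"
  shows "eval (\<lambda>i. c * x i) f = c ^ d * eval x f"
proof -
  have "eval (\<lambda>i. c ^ 1 * x i) f = (\<Sum>m\<in>keys f. lookup f m * (c ^ weight (\<lambda>_. 1) m * mon_at x m))"
    unfolding eval_eq_sum mon_at_weighted ..
  also have "\<dots> = (\<Sum>m\<in>keys f. c ^ d * (lookup f m * mon_at x m))"
    using assms by (intro sum.cong) (auto simp: homogeneous_iff_weight)
  finally show ?thesis
    by (simp add: eval_eq_sum sum_distrib_left)
qed

section \<open>Closed sets of projective space\<close>

lemma proj_class_eq_iff:
  "x \<noteq> 0 \<Longrightarrow> y \<noteq> 0 \<Longrightarrow> proj_class x = proj_class y \<longleftrightarrow> (\<exists>c. c \<noteq> 0 \<and> y = c *s x)"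
proof -
  assume nz: "x \<noteq> 0" "y \<noteq> 0"
  have refl: "proj_rel z z" if "z \<noteq> 0" for z :: "complex^'n"
    using that unfolding proj_rel_def by (intro conjI exI[of _ 1]) auto
  have "proj_rel x y \<longleftrightarrow> proj_class x = proj_class y"
    using Quotient3_rel[OF Quotient3_proj, of x y] refl nz by auto
  then show ?thesis
    using nz by (auto simp: proj_rel_def)
qed

lemma coords_proj_class: "x \<noteq> 0 \<Longrightarrow> coords (proj_class x) = {c *s x | c. c \<noteq> 0}"
proof -
  assume x: "x \<noteq> 0"
  have "y \<noteq> 0 \<and> proj_class y = proj_class x \<longleftrightarrow> (\<exists>c. c \<noteq> 0 \<and> y = c *s x)" for y
    using proj_class_eq_iff[OF x, of y] x by (cases "y = 0") auto
  then show ?thesis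
    by (auto simp: coords_def)
qed

lemma proj_exhaust:
  obtains x where "x \<noteq> 0" "X = proj_class x"
  by (induction X rule: proj.abs_induct) (auto simp: proj_rel_def)

lemma vec_nth_scale: "($) (c *s x) = (\<lambda>i. c * x $ i)"
  by (simp add: fun_eq_iff)

lemma vanishes_proj_class:
  "x \<noteq> 0 \<Longrightarrow> vanishes f (proj_class x) \<longleftrightarrow> (\<forall>c. c \<noteq> 0 \<longrightarrow> eval (\<lambda>i. c * x $ i) f = 0)"
  by (force simp: vanishes_def coords_proj_class vec_nth_scale)

lemma vanishes_homogeneous:
  "homogeneous d f \<Longrightarrow> x \<noteq> 0 \<Longrightarrow> vanishes f (proj_class x) \<longleftrightarrow> eval (\<lambda>i. x $ i) f = 0"
  by (auto simp: vanishes_proj_class eval_homogeneous_scale dest: spec[of _ 1])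

lemma vanishes_iff_graded_parts:
  "vanishes f X \<longleftrightarrow> (\<forall>d. vanishes (graded_part (\<lambda>_. 1) d f) X)"
proof (cases X rule: proj_exhaust)
  case (1 x)
  show ?thesis
  proof (intro iffI allI)
    fix d assume "vanishes f X"
    then have *: "eval (\<lambda>i. c * x $ i) f = 0" if "c \<noteq> 0" for c
      using that 1 by (simp add: vanishes_proj_class)
    have "eval (\<lambda>i. c * x $ i) (graded_part (\<lambda>_. 1) d f) = 0" if "c \<noteq> 0" for c
    proof (rule eval_graded_part_zero)
      show "eval (\<lambda>i. b ^ 1 * (c * x $ i)) f = 0" if "b \<noteq> 0" for b
        using *[of "b * c"] that \<open>c \<noteq> 0\<close> by (simp add: mult_ac)
    qed
    then show "vanishes (graded_part (\<lambda>_. 1) d f) X"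
      using 1 by (simp add: vanishes_proj_class)
  next
    assume "\<forall>d. vanishes (graded_part (\<lambda>_. 1) d f) X"
    then have "eval (\<lambda>i. c * x $ i) (graded_part (\<lambda>_. 1) d f) = 0" if "c \<noteq> 0" for c d
      using 1 that by (simp add: vanishes_proj_class)
    then show "vanishes f X"
      using 1 eval_zero_if_graded_parts_zero by (metis vanishes_proj_class)
  qed
qed

lemma homogeneous_graded_part: "homogeneous d (graded_part (\<lambda>_. 1) d f)"
  by (auto simp: homogeneous_iff_weight keys_graded_part)

lemma zariski_closed_zero_locus: "zariski_closed (zero_locus F)"
  unfolding zariski_closed_def
proof (intro exI conjI)
  show "\<forall>g\<in>{graded_part (\<lambda>_. 1) d f | d f. f \<in> F}. \<exists>d. homogeneous d g"
    using homogeneous_graded_part by blast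
  show "zero_locus F = zero_locus {graded_part (\<lambda>_. 1) d f | d f. f \<in> F}"
  proof -
    have "X \<in> zero_locus F \<longleftrightarrow> (\<forall>f\<in>F. vanishes f X)" for X
      by (simp add: zero_locus_def)
    also have "\<dots> X \<longleftrightarrow> (\<forall>f\<in>F. \<forall>d. vanishes (graded_part (\<lambda>_. 1) d f) X)" for X
      by (rule ball_cong[OF refl vanishes_iff_graded_parts])
    also have "\<dots> X \<longleftrightarrow> X \<in> zero_locus {graded_part (\<lambda>_. 1) d f | d f. f \<in> F}" for X
      by (auto simp: zero_locus_def)
    finally show ?thesis
      by blast
  qed
qed

lemma vanishes2_proj_class:
  "x \<noteq> 0 \<Longrightarrow> y \<noteq> 0 \<Longrightarrow> vanishes2 f (proj_class x, proj_class y) \<longleftrightarrow>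
     (\<forall>a b. a \<noteq> 0 \<longrightarrow> b \<noteq> 0 \<longrightarrow> eval (case_sum (\<lambda>i. a * x $ i) (\<lambda>i. b * y $ i)) f = 0)"
proof -
  assume xy: "x \<noteq> 0" "y \<noteq> 0"
  have "vanishes2 f (proj_class x, proj_class y) \<longleftrightarrow>
      (\<forall>a. a \<noteq> 0 \<longrightarrow> (\<forall>b. b \<noteq> 0 \<longrightarrow> eval (case_sum (($) (a *s x)) (($) (b *s y))) f = 0))"
    unfolding vanishes2_def eval2_def fst_conv snd_conv coords_proj_class[OF xy(1)] coords_proj_class[OF xy(2)] by blast
  then show ?thesis
    unfolding vec_nth_scale by blast
qed

definition bigraded_part :: "nat \<Rightarrow> nat \<Rightarrow> ('n::finite + 'n) cpoly \<Rightarrow> ('n + 'n) cpoly" where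
  "bigraded_part d e f =
     graded_part (case_sum (\<lambda>_. 1) (\<lambda>_. 0)) d (graded_part (case_sum (\<lambda>_. 0) (\<lambda>_. 1)) e f)"

lemma sum_UNIV_Plus:
  "(\<Sum>i\<in>UNIV. h i) = (\<Sum>i\<in>UNIV. h (Inl i)) + (\<Sum>i\<in>UNIV. h (Inr i))"
  for h :: "'a::finite + 'b::finite \<Rightarrow> 'c::comm_monoid_add"
  by (subst UNIV_Plus_UNIV[symmetric], subst sum.Plus) auto

lemma prod_UNIV_Plus:
  "(\<Prod>i\<in>UNIV. h i) = (\<Prod>i\<in>UNIV. h (Inl i)) * (\<Prod>i\<in>UNIV. h (Inr i))"
  for h :: "'a::finite + 'b::finite \<Rightarrow> 'c::comm_monoid_mult"
  by (subst UNIV_Plus_UNIV[symmetric], subst prod.Plus) auto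

lemma bihomogeneous_bigraded_part: "bihomogeneous d e (bigraded_part d e f)"
  by (auto simp: bihomogeneous_def bigraded_part_def keys_graded_part weight_def sum_UNIV_Plus)

lemma vanishes2_iff_bigraded_parts:
  "vanishes2 f XY \<longleftrightarrow> (\<forall>d e. vanishes2 (bigraded_part d e f) XY)"
proof -
  obtain x y where xy: "x \<noteq> 0" "y \<noteq> 0" "XY = (proj_class x, proj_class y)"
    by (metis proj_exhaust surj_pair)
  show ?thesis
  proof (intro iffI allI)
    fix d e assume "vanishes2 f XY"
    then have *: "eval (case_sum (\<lambda>i. a * x $ i) (\<lambda>i. b * y $ i)) f = 0" if "a \<noteq> 0" "b \<noteq> 0" for a b
      using that xy by (simp add: vanishes2_proj_class)
    have **: "eval (case_sum (\<lambda>i. a * x $ i) (\<lambda>i. b * y $ i)) (graded_part (case_sum (\<lambda>_. 0) (\<lambda>_. 1)) e f) = 0"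
      if "a \<noteq> 0" "b \<noteq> 0" for a b
    proof (rule eval_graded_part_zero)
      fix c :: complex assume "c \<noteq> 0"
      have "(\<lambda>i. c ^ case_sum (\<lambda>_. 0) (\<lambda>_. 1) i * case_sum (\<lambda>i. a * x $ i) (\<lambda>i. b * y $ i) i)
        = case_sum (\<lambda>i. a * x $ i) (\<lambda>i. (c * b) * y $ i)"
        by (auto simp: fun_eq_iff split: sum.split)
      then show "eval (\<lambda>i. c ^ case_sum (\<lambda>_. 0) (\<lambda>_. 1) i * case_sum (\<lambda>i. a * x $ i) (\<lambda>i. b * y $ i) i) f = 0"
        using *[of a "c * b"] that \<open>c \<noteq> 0\<close> by simp
    qed
    have "eval (case_sum (\<lambda>i. a * x $ i) (\<lambda>i. b * y $ i)) (bigraded_part d e f) = 0"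
      if "a \<noteq> 0" "b \<noteq> 0" for a b
      unfolding bigraded_part_def
    proof (rule eval_graded_part_zero)
      fix c :: complex assume "c \<noteq> 0"
      have "(\<lambda>i. c ^ case_sum (\<lambda>_. 1) (\<lambda>_. 0) i * case_sum (\<lambda>i. a * x $ i) (\<lambda>i. b * y $ i) i)
        = case_sum (\<lambda>i. (c * a) * x $ i) (\<lambda>i. b * y $ i)"
        by (auto simp: fun_eq_iff split: sum.split)
      then show "eval (\<lambda>i. c ^ case_sum (\<lambda>_. 1) (\<lambda>_. 0) i * case_sum (\<lambda>i. a * x $ i) (\<lambda>i. b * y $ i) i)
          (graded_part (case_sum (\<lambda>_. 0) (\<lambda>_. 1)) e f) = 0"
        using **[of "c * a" b] that \<open>c \<noteq> 0\<close> by simp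
    qed
    then show "vanishes2 (bigraded_part d e f) XY"
      using xy by (simp add: vanishes2_proj_class)
  next
    assume "\<forall>d e. vanishes2 (bigraded_part d e f) XY"
    then have *: "eval (case_sum (\<lambda>i. a * x $ i) (\<lambda>i. b * y $ i)) (bigraded_part d e f) = 0"
      if "a \<noteq> 0" "b \<noteq> 0" for a b d e
      using xy that by (simp add: vanishes2_proj_class)
    have "eval (case_sum (\<lambda>i. a * x $ i) (\<lambda>i. b * y $ i)) f = 0" if "a \<noteq> 0" "b \<noteq> 0" for a b
      by (rule eval_zero_if_graded_parts_zero[where w = "case_sum (\<lambda>_. 0) (\<lambda>_. 1)"],
          rule eval_zero_if_graded_parts_zero[where w = "case_sum (\<lambda>_. 1) (\<lambda>_. 0)"])
         (rule *[OF that, unfolded bigraded_part_def])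
    then show "vanishes2 f XY"
      using xy by (simp add: vanishes2_proj_class)
  qed
qed

lemma zariski_closed2_zero_locus2: "zariski_closed2 (zero_locus2 F)"
  unfolding zariski_closed2_def
proof (intro exI conjI)
  show "\<forall>g\<in>{bigraded_part d e f | d e f. f \<in> F}. \<exists>d e. bihomogeneous d e g"
    using bihomogeneous_bigraded_part by blast
  show "zero_locus2 F = zero_locus2 {bigraded_part d e f | d e f. f \<in> F}"
  proof -
    have "X \<in> zero_locus2 F \<longleftrightarrow> (\<forall>f\<in>F. vanishes2 f X)" for X
      by (simp add: zero_locus2_def)
    also have "\<dots> X \<longleftrightarrow> (\<forall>f\<in>F. \<forall>d e. vanishes2 (bigraded_part d e f) X)" for X
      by (rule ball_cong[OF refl vanishes2_iff_bigraded_parts])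
    also have "\<dots> X \<longleftrightarrow> X \<in> zero_locus2 {bigraded_part d e f | d e f. f \<in> F}" for X
      by (auto simp: zero_locus2_def)
    finally show ?thesis
      by blast
  qed
qed

lemma vanishing_ideal2_hull: "vanishing_ideal2 (zariski_closed2 hull S) = vanishing_ideal2 S"
proof
  show "vanishing_ideal2 (zariski_closed2 hull S) \<subseteq> vanishing_ideal2 S"
    using hull_subset[of S zariski_closed2] by (auto simp: vanishing_ideal2_def)
  have "zariski_closed2 hull S \<subseteq> zero_locus2 (vanishing_ideal2 S)"
    by (rule hull_minimal[where S = zariski_closed2, OF _ zariski_closed2_zero_locus2])
       (auto simp: zero_locus2_def vanishing_ideal2_def)
  then show "vanishing_ideal2 S \<subseteq> vanishing_ideal2 (zariski_closed2 hull S)"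
    by (auto simp: vanishing_ideal2_def zero_locus2_def)
qed

lemma irreducible_mult_zero:
  assumes "zariski_irreducible C" "homogeneous d f" "\<not> C \<subseteq> zero_locus {f}"
    and "\<And>x. x \<noteq> 0 \<Longrightarrow> proj_class x \<in> C \<Longrightarrow> eval (\<lambda>i. x $ i) (f * g) = 0"
    and "x \<noteq> 0" "proj_class x \<in> C"
  shows "eval (\<lambda>i. x $ i) g = 0"
proof -
  have "C \<subseteq> zero_locus {f} \<union> zero_locus {g}"
  proof
    fix X assume "X \<in> C"
    obtain z where z: "z \<noteq> 0" "X = proj_class z"
      using proj_exhaust by blast
    show "X \<in> zero_locus {f} \<union> zero_locus {g}"
    proof (cases "eval (\<lambda>i. z $ i) f = 0")
      case True
      then show ?thesis
        using z assms(2) by (auto simp: zero_locus_def vanishes_homogeneous)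
    next
      case False
      have "eval (\<lambda>i. c * z $ i) g = 0" if "c \<noteq> 0" for c
      proof -
        have "c *s z \<noteq> 0" "proj_class (c *s z) = X"
          using that z coords_proj_class[of z] by (auto simp: coords_def)
        then have "eval (\<lambda>i. c * z $ i) (f * g) = 0"
          using assms(4)[of "c *s z"] \<open>X \<in> C\<close> by simp
        then show ?thesis
          using False that by (simp add: eval_homogeneous_scale[OF assms(2)])
      qed
      then show ?thesis
        using z by (simp add: zero_locus_def vanishes_proj_class)
    qed
  qed
  then have "C \<subseteq> zero_locus {g}"
    using assms(1,3) zariski_closed_zero_locus unfolding zariski_irreducible_def by blast
  then have "vanishes g (proj_class x)"
    using assms(6) by (auto simp: zero_locus_def)
  then show ?thesis
    using assms(5) by (auto simp: vanishes_proj_class dest: spec[of _ 1])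
qed

section \<open>Ideals\<close>

lemma module_mult: "module ((*) :: 'r::comm_ring_1 \<Rightarrow> 'r \<Rightarrow> 'r)"
  by unfold_locales (auto simp: algebra_simps)

lemma ideal_gen_base: "s \<in> S \<Longrightarrow> s \<in> ideal_gen S"
  unfolding ideal_gen_def by (rule module.span_base[OF module_mult])

lemma ideal_gen_zero [simp]: "0 \<in> ideal_gen S"
  unfolding ideal_gen_def by (rule module.span_zero[OF module_mult])

lemma ideal_gen_add: "a \<in> ideal_gen S \<Longrightarrow> b \<in> ideal_gen S \<Longrightarrow> a + b \<in> ideal_gen S"
  unfolding ideal_gen_def by (rule module.span_add[OF module_mult])

lemma ideal_gen_diff: "a \<in> ideal_gen S \<Longrightarrow> b \<in> ideal_gen S \<Longrightarrow> a - b \<in> ideal_gen S"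
  unfolding ideal_gen_def by (rule module.span_diff[OF module_mult])

lemma ideal_gen_mult: "a \<in> ideal_gen S \<Longrightarrow> c * a \<in> ideal_gen S"
  unfolding ideal_gen_def by (rule module.span_scale[OF module_mult])

lemma ideal_gen_sum: "(\<And>i. i \<in> I \<Longrightarrow> f i \<in> ideal_gen S) \<Longrightarrow> (\<Sum>i\<in>I. f i) \<in> ideal_gen S"
  unfolding ideal_gen_def by (rule module.span_sum[OF module_mult])

lemma ideal_gen_induct [consumes 1, case_names zero step]:
  assumes "a \<in> ideal_gen S" "P 0" "\<And>c s y. s \<in> S \<Longrightarrow> P y \<Longrightarrow> P (c * s + y)"
  shows "P a"
  using assms unfolding ideal_gen_def by (rule module.span_induct_alt[OF module_mult])

lemma ideal_gen_subset: "S \<subseteq> ideal_gen T \<Longrightarrow> ideal_gen S \<subseteq> ideal_gen T"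
proof
  fix a assume "S \<subseteq> ideal_gen T" "a \<in> ideal_gen S"
  from this(2,1) show "a \<in> ideal_gen T"
    by (induction rule: ideal_gen_induct) (auto intro: ideal_gen_add ideal_gen_mult)
qed

lemma eval_ideal_gen_zero:
  fixes x :: "'v::finite \<Rightarrow> complex"
  assumes "f \<in> ideal_gen S" "\<And>s. s \<in> S \<Longrightarrow> eval x s = 0"
  shows "eval x f = 0"
  using assms by (induction rule: ideal_gen_induct) auto

section \<open>Integer matrices and their complex row spaces\<close>

lemma common_denominator:
  assumes "finite S"
  shows "\<exists>D::int. D > 0 \<and> (\<forall>q\<in>S. \<exists>z. of_int D * q = (of_int z :: rat))"
  using assms
proof (induction S rule: finite_induct)
  case empty
  then show ?case by (auto intro: exI[of _ 1])
next
  case (insert q S)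
  then obtain D where D: "D > 0" "\<forall>q\<in>S. \<exists>z. of_int D * q = of_int z"
    by auto
  obtain a b where ab: "quotient_of q = (a, b)" by force
  have b: "b > 0" "q = of_int a / of_int b"
    using quotient_of_denom_pos[OF ab] quotient_of_div[OF ab] by auto
  have nz: "(of_int b :: rat) \<noteq> 0"
    using b(1) by simp
  have "of_int b * q = of_int a"
    using nz b(2) by (metis nonzero_mult_div_cancel_left times_divide_eq_right)
  then have "of_int (D * b) * q = of_int (D * a)"
    by (simp only: of_int_mult mult.assoc)
  moreover have "\<exists>z. of_int (D * b) * q' = (of_int z :: rat)" if q': "q' \<in> S" for q'
  proof -
    obtain z where "of_int D * q' = of_int z"
      using D(2) q' by blast
    then have "of_int (D * b) * q' = of_int (z * b)"
      by (metis of_int_mult mult.assoc mult.commute)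
    then show ?thesis by (rule exI)
  qed
  ultimately have "\<forall>q'\<in>insert q S. \<exists>z. of_int (D * b) * q' = of_int z"
    by blast
  moreover have "D * b > 0"
    using D(1) b(1) by simp
  ultimately show ?case
    by blast
qed

lemma integral_generalized_inverse:
  fixes A :: "int^'n::finite^'m::finite"
  obtains R :: "int^'m^'n" and D :: int where "D > 0"
    "\<And>k j. (\<Sum>i\<in>UNIV. A $ k $ i * (\<Sum>l\<in>UNIV. R $ i $ l * A $ l $ j)) = D * A $ k $ j"
proof -
  define B :: "rat^'n^'m" where "B = (\<chi> k j. of_int (A $ k $ j))"
  obtain g :: "rat^'m \<Rightarrow> rat^'n" where g: "Vector_Spaces.linear (*s) (*s) g"
      "\<And>v. v \<in> range ((*v) B) \<Longrightarrow> B *v g v = v"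
    using vec.linear_exists_right_inverse_on[OF matrix_vector_mul_linear_gen[of B] vec.subspace_UNIV]
    by blast
  define G where "G = matrix g"
  have "B *v (G *v (B *v x)) = B *v x" for x
    using g(2)[of "B *v x"] by (simp add: G_def matrix_works[OF g(1)])
  then have "B ** (G ** B) = B"
    by (simp add: matrix_eq matrix_vector_mul_assoc)
  then have BGB: "(\<Sum>i\<in>UNIV. B $ k $ i * (\<Sum>l\<in>UNIV. G $ i $ l * B $ l $ j)) = B $ k $ j" for k j
    unfolding vec_eq_iff matrix_matrix_mult_def by simp
  obtain D :: int where D: "D > 0" "\<And>i l. \<exists>z. of_int D * G $ i $ l = of_int z"
    using common_denominator[of "range (\<lambda>(i, l). G $ i $ l)"] by auto
  then obtain Z where Z: "\<And>i l. of_int D * G $ i $ l = of_int (Z i l)"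
    by metis
  have "(\<Sum>i\<in>UNIV. A $ k $ i * (\<Sum>l\<in>UNIV. Z i l * A $ l $ j)) = D * A $ k $ j" for k j
  proof -
    have "(of_int (\<Sum>i\<in>UNIV. A $ k $ i * (\<Sum>l\<in>UNIV. Z i l * A $ l $ j)) :: rat)
        = (\<Sum>i\<in>UNIV. B $ k $ i * (\<Sum>l\<in>UNIV. of_int D * G $ i $ l * B $ l $ j))"
      by (simp add: Z B_def)
    also have "\<dots> = of_int D * (\<Sum>i\<in>UNIV. B $ k $ i * (\<Sum>l\<in>UNIV. G $ i $ l * B $ l $ j))"
      by (simp add: sum_distrib_left mult_ac)
    also have "\<dots> = of_int (D * A $ k $ j)"
      by (simp only: BGB) (simp add: B_def)
    finally show ?thesis
      by (simp only: of_int_eq_iff)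
  qed
  then show ?thesis
    using that[of D "\<chi> i l. Z i l"] D(1) by simp
qed

definition row_space :: "int^'n::finite^'m::finite \<Rightarrow> (complex^'n) set" where
  "row_space A = {\<chi> j. \<Sum>k\<in>UNIV. \<theta> k * of_int (A $ k $ j) | \<theta>. True}"

lemma row_space_intro: "(\<chi> j. \<Sum>k\<in>UNIV. \<theta> k * of_int (A $ k $ j)) \<in> row_space A"
  by (auto simp: row_space_def)

lemma row_space_perp:
  assumes "r \<in> row_space A" and b: "\<And>k. (\<Sum>i\<in>UNIV. of_int (A $ k $ i) * b i) = 0"
  shows "(\<Sum>i\<in>UNIV. b i * r $ i) = 0"
proof -
  obtain \<theta> where \<theta>: "r = (\<chi> j. \<Sum>k\<in>UNIV. \<theta> k * of_int (A $ k $ j))"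
    using assms(1) by (auto simp: row_space_def)
  have "(\<Sum>i\<in>UNIV. b i * r $ i) = (\<Sum>k\<in>UNIV. \<theta> k * (\<Sum>i\<in>UNIV. of_int (A $ k $ i) * b i))"
    unfolding \<theta> sum_distrib_left by (subst sum.swap) (simp add: sum_distrib_left mult_ac)
  then show ?thesis
    by (simp add: b)
qed

lemma row_space_iff:
  "r \<in> row_space A \<longleftrightarrow> (\<forall>b. A *v b = 0 \<longrightarrow> (\<Sum>i\<in>UNIV. of_int (b $ i) * r $ i) = 0)"
proof (intro iffI allI impI)
  fix b assume "r \<in> row_space A" "A *v b = 0"
  show "(\<Sum>i\<in>UNIV. of_int (b $ i) * r $ i) = 0"
  proof (rule row_space_perp[OF \<open>r \<in> row_space A\<close>])
    fix k
    have "(\<Sum>i\<in>UNIV. A $ k $ i * b $ i) = 0"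
      using \<open>A *v b = 0\<close> by (simp add: vec_eq_iff matrix_vector_mult_def)
    then show "(\<Sum>i\<in>UNIV. of_int (A $ k $ i) * of_int (b $ i)) = (0::complex)"
      by (metis (mono_tags, lifting) of_int_0 of_int_mult of_int_sum sum.cong)
  qed
next
  assume perp: "\<forall>b. A *v b = 0 \<longrightarrow> (\<Sum>i\<in>UNIV. of_int (b $ i) * r $ i) = 0"
  obtain R D where RD: "D > 0"
    "\<And>k j. (\<Sum>i\<in>UNIV. A $ k $ i * (\<Sum>l\<in>UNIV. R $ i $ l * A $ l $ j)) = D * A $ k $ j"
    using integral_generalized_inverse by blast
  define \<theta> where "\<theta> k = (\<Sum>i\<in>UNIV. r $ i * of_int (R $ i $ k)) / of_int D" for k
  have "r $ j = (\<Sum>k\<in>UNIV. \<theta> k * of_int (A $ k $ j))" for j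
  proof -
    define b :: "int^_" where
      "b = (\<chi> i. (if i = j then D else 0) - (\<Sum>l\<in>UNIV. R $ i $ l * A $ l $ j))"
    have "A *v b = 0"
      by (simp add: vec_eq_iff matrix_vector_mult_def b_def right_diff_distrib sum_subtractf RD(2)
          if_distrib[of "\<lambda>z. _ * z"] cong: if_cong)
    then have "0 = (\<Sum>i\<in>UNIV. of_int (b $ i) * r $ i)"
      using perp by simp
    also have "\<dots> = (\<Sum>i\<in>UNIV. (if i = j then of_int D * r $ j else 0) -
        (\<Sum>l\<in>UNIV. r $ i * of_int (R $ i $ l) * of_int (A $ l $ j)))"
      by (intro sum.cong) (auto simp: b_def right_diff_distrib sum_distrib_left mult_ac)
    also have "\<dots> = of_int D * r $ j - (\<Sum>i\<in>UNIV. \<Sum>l\<in>UNIV. r $ i * of_int (R $ i $ l) * of_int (A $ l $ j))"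
      by (simp add: sum_subtractf)
    also have "(\<Sum>i\<in>UNIV. \<Sum>l\<in>UNIV. r $ i * of_int (R $ i $ l) * of_int (A $ l $ j))
        = of_int D * (\<Sum>k\<in>UNIV. \<theta> k * of_int (A $ k $ j))"
    proof -
      have D\<theta>: "of_int D * \<theta> k = (\<Sum>i\<in>UNIV. r $ i * of_int (R $ i $ k))" for k
        using RD(1) by (simp add: \<theta>_def)
      have "of_int D * (\<Sum>k\<in>UNIV. \<theta> k * of_int (A $ k $ j)) =
          (\<Sum>k\<in>UNIV. (of_int D * \<theta> k) * of_int (A $ k $ j))"
        by (simp only: sum_distrib_left mult.assoc)
      then show ?thesis
        unfolding D\<theta> by (subst sum.swap) (simp only: sum_distrib_right)
    qed
    finally show ?thesis
      using RD(1) by simp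
  qed
  then have "r = (\<chi> j. \<Sum>k\<in>UNIV. \<theta> k * of_int (A $ k $ j))"
    by (simp add: vec_eq_iff)
  then show "r \<in> row_space A"
    by (auto simp: row_space_def)
qed

lemma subspace_row_space: "vec.subspace (row_space A)"
  unfolding vec.subspace_def
  by (auto simp: row_space_iff distrib_left sum.distrib mult.left_commute[of _ "_::complex"]
      simp flip: sum_distrib_left)

section \<open>The toric model\<close>

lemma expo_diff_surj:
  obtains v w where "expo v - expo w = b"
proof
  let ?v = "Poly_Mapping.Abs_poly_mapping (\<lambda>i. nat (b $ i))"
  let ?w = "Poly_Mapping.Abs_poly_mapping (\<lambda>i. nat (- b $ i))"
  show "expo ?v - expo ?w = b"
    by (simp add: expo_def vec_eq_iff lookup_Abs_poly_mapping)
qed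

definition toric_point :: "int^'n::finite^'m \<Rightarrow> ('n \<Rightarrow> complex) \<Rightarrow> bool" where
  "toric_point A x \<longleftrightarrow> (\<forall>v w. A *v expo v = A *v expo w \<longrightarrow> mon_at x v = mon_at x w)"

lemma toric_pointD:
  "toric_point A x \<Longrightarrow> A *v expo v = A *v expo w \<Longrightarrow> mon_at x v = mon_at x w"
  unfolding toric_point_def by blast

lemma toric_ideal_base:
  "A *v expo v = A *v expo w \<Longrightarrow> monomial v - monomial w \<in> toric_ideal A"
  unfolding toric_ideal_def by (rule ideal_gen_base) blast

lemma eval_toric_ideal: "toric_point A x \<Longrightarrow> f \<in> toric_ideal A \<Longrightarrow> eval x f = 0"
  unfolding toric_ideal_def
  by (erule eval_ideal_gen_zero) (auto dest: toric_pointD)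

lemma toric_point_one: "toric_point A (\<lambda>_. 1)"
  by (simp add: toric_point_def mon_at_def)

lemma weight_eq:
  assumes "homogeneous_ideal (toric_ideal A)" "A *v expo v = A *v expo w"
  shows "weight (\<lambda>_. 1) v = weight (\<lambda>_. 1) w"
proof -
  obtain S where S: "\<forall>f\<in>S. \<exists>d. homogeneous d f" "toric_ideal A = ideal_gen S"
    using assms(1) by (auto simp: homogeneous_ideal_def)
  have "eval (\<lambda>_. 2) f = 0" if f: "f \<in> S" for f
  proof -
    obtain d where "homogeneous d f"
      using S f by blast
    moreover have "eval (\<lambda>_. 1) f = 0"
      using S f by (intro eval_toric_ideal[OF toric_point_one, of _ A]) (simp add: ideal_gen_base)
    ultimately show ?thesis
      using eval_homogeneous_scale[of d f 2 "\<lambda>_. 1"] by simp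
  qed
  then have "eval (\<lambda>_. 2) (monomial v - monomial w) = 0"
    using toric_ideal_base[OF assms(2)] unfolding S(2) by (rule eval_ideal_gen_zero[rotated])
  then have "(2::complex) ^ weight (\<lambda>_. 1) v = 2 ^ weight (\<lambda>_. 1) w"
    by (simp add: mon_at_def weight_def power_sum)
  then have "(2::real) ^ weight (\<lambda>_. 1) v = 2 ^ weight (\<lambda>_. 1) w"
    by (metis (mono_tags, lifting) of_real_eq_iff of_real_numeral of_real_power)
  then show ?thesis
    by simp
qed

lemma one_in_row_space:
  assumes "homogeneous_ideal (toric_ideal A)"
  shows "1 \<in> row_space A"
  unfolding row_space_iff
proof (intro allI impI)
  fix b assume "A *v b = 0"
  obtain v w where vw: "expo v - expo w = b"
    using expo_diff_surj .
  then have "A *v expo v = A *v expo w"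
    using \<open>A *v b = 0\<close> by (metis eq_iff_diff_eq_0 matrix_vector_mult_diff_distrib)
  then have "weight (\<lambda>_. 1) v = weight (\<lambda>_. 1) w"
    by (rule weight_eq[OF assms])
  then have "(\<Sum>i\<in>UNIV. int (lookup v i)) = (\<Sum>i\<in>UNIV. int (lookup w i))"
    by (simp add: weight_def flip: of_nat_sum)
  then have "(\<Sum>i\<in>UNIV. b $ i) = 0"
    by (simp add: vw[symmetric] expo_def sum_subtractf)
  then show "(\<Sum>i\<in>UNIV. of_int (b $ i) * (1::complex^_) $ i) = 0"
    by (simp flip: of_int_sum)
qed

lemma toric_point_scale:
  assumes "homogeneous_ideal (toric_ideal A)" "toric_point A x"
  shows "toric_point A (\<lambda>i. c * x i)"
proof -
  have "mon_at (\<lambda>i. c * x i) v = c ^ weight (\<lambda>_. 1) v * mon_at x v" for v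
    using mon_at_weighted[of c "\<lambda>_. 1" x v] by simp
  then show ?thesis
    using weight_eq[OF assms(1)] toric_pointD[OF assms(2)] unfolding toric_point_def by metis
qed

lemma toric_model_iff:
  assumes "homogeneous_ideal (toric_ideal A)" "x \<noteq> 0"
  shows "proj_class x \<in> toric_model A \<longleftrightarrow> toric_point A (\<lambda>i. x $ i)"
proof
  assume "proj_class x \<in> toric_model A"
  then have van: "vanishes f (proj_class x)" if "f \<in> toric_ideal A" for f
    using that by (simp add: toric_model_def zero_locus_def)
  show "toric_point A (\<lambda>i. x $ i)"
    unfolding toric_point_def
  proof (intro allI impI)
    fix v w assume "A *v expo v = A *v expo w"
    then have "eval (\<lambda>i. 1 * x $ i) (monomial v - monomial w) = 0"
      using van[OF toric_ideal_base] vanishes_proj_class[OF assms(2)] zero_neq_one by metis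
    then show "mon_at (\<lambda>i. x $ i) v = mon_at (\<lambda>i. x $ i) w"
      by simp
  qed
next
  assume "toric_point A (\<lambda>i. x $ i)"
  then have "vanishes f (proj_class x)" if "f \<in> toric_ideal A" for f
    unfolding vanishes_proj_class[OF assms(2)]
    using eval_toric_ideal[OF toric_point_scale[OF assms(1)] that] by blast
  then show "proj_class x \<in> toric_model A"
    by (simp add: toric_model_def zero_locus_def)
qed

lemma toric_point_exp:
  assumes "toric_point A x" "r \<in> row_space A"
  shows "toric_point A (\<lambda>i. x i * exp (r $ i))"
  unfolding toric_point_def
proof (intro allI impI)
  fix v w assume vw: "A *v expo v = A *v expo w"
  then have "A *v (expo v - expo w) = 0"
    by (simp add: matrix_vector_mult_diff_distrib)
  then have "(\<Sum>i\<in>UNIV. of_int ((expo v - expo w) $ i) * r $ i) = 0"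
    using assms(2) row_space_iff by blast
  then have "(\<Sum>i\<in>UNIV. of_nat (lookup v i) * r $ i) = (\<Sum>i\<in>UNIV. of_nat (lookup w i) * r $ i)"
    by (simp add: expo_def left_diff_distrib sum_subtractf)
  then show "mon_at (\<lambda>i. x i * exp (r $ i)) v = mon_at (\<lambda>i. x i * exp (r $ i)) w"
    using toric_pointD[OF assms(1) vw] by (simp add: mon_at_mult mon_at_exp)
qed

section \<open>Tangent spaces of the toric model\<close>

lemma eval_pdiff:
  fixes x :: "'v::finite \<Rightarrow> complex"
  assumes "finite S" "keys f \<subseteq> S"
  shows "eval x (pdiff i f) * x i = (\<Sum>m\<in>S. lookup f m * mon_at x m * of_nat (lookup m i))"
proof -
  have "mon_at x (m - Poly_Mapping.single i 1) * x i = mon_at x m" if "lookup m i \<noteq> 0" for m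
  proof -
    have "m = (m - Poly_Mapping.single i 1) + Poly_Mapping.single i 1"
      using that by (intro poly_mapping_eqI) (auto simp: lookup_add lookup_minus lookup_single when_def)
    then have "mon_at x m = mon_at x ((m - Poly_Mapping.single i 1) + Poly_Mapping.single i 1)"
      by simp
    then show ?thesis
      unfolding mon_at_add by simp
  qed
  then have *: "of_nat (lookup m i) * lookup f m * mon_at x (m - Poly_Mapping.single i 1) * x i
      = lookup f m * mon_at x m * of_nat (lookup m i)" for m
    by (cases "lookup m i = 0") (simp_all add: mult_ac)
  have "eval x (pdiff i f) * x i = (\<Sum>m\<in>keys f. lookup f m * mon_at x m * of_nat (lookup m i))"
    by (simp add: pdiff_def eval_single sum_distrib_right * del: One_nat_def)
  also have "\<dots> = (\<Sum>m\<in>S. lookup f m * mon_at x m * of_nat (lookup m i))"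
    using assms by (intro sum.mono_neutral_left) (auto simp: in_keys_iff)
  finally show ?thesis .
qed

lemma eval_directional_derivative:
  fixes x :: "'v::finite \<Rightarrow> complex"
  assumes "finite S" "keys f \<subseteq> S"
  shows "(\<Sum>i\<in>UNIV. eval x (pdiff i f) * (x i * r i)) =
    (\<Sum>m\<in>S. lookup f m * mon_at x m * (\<Sum>i\<in>UNIV. of_nat (lookup m i) * r i))"
proof -
  have "(\<Sum>i\<in>UNIV. eval x (pdiff i f) * (x i * r i)) = (\<Sum>i\<in>UNIV. (eval x (pdiff i f) * x i) * r i)"
    by (simp add: mult.assoc)
  also have "\<dots> = (\<Sum>m\<in>S. \<Sum>i\<in>UNIV. lookup f m * mon_at x m * of_nat (lookup m i) * r i)"
    by (subst sum.swap) (simp add: eval_pdiff[OF assms] sum_distrib_right)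
  finally show ?thesis
    by (simp add: sum_distrib_left mult.assoc)
qed

lemma exp_sum_derivative:
  fixes a s :: "'i \<Rightarrow> complex"
  shows "((\<lambda>z. \<Sum>m\<in>K. a m * exp (z * s m)) has_field_derivative (\<Sum>m\<in>K. a m * s m)) (at 0)"
proof (rule DERIV_sum)
  show "((\<lambda>z. a m * exp (z * s m)) has_field_derivative a m * s m) (at 0)" for m
    by (auto intro!: derivative_eq_intros)
qed

lemma cone_tangent_toric_model:
  fixes A :: "int^'n::finite^'m::finite"
  assumes hom: "homogeneous_ideal (toric_ideal A)"
    and x: "toric_point A (\<lambda>i. x $ i)" "\<And>i. x $ i \<noteq> 0"
  shows "cone_tangent (toric_model A) x = (\<lambda>r. \<chi> i. x $ i * r $ i) ` row_space A"
proof (intro equalityI subsetI)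
  fix t assume "t \<in> (\<lambda>r. \<chi> i. x $ i * r $ i) ` row_space A"
  then obtain r where r: "r \<in> row_space A" "t = (\<chi> i. x $ i * r $ i)"
    by blast
  have "(\<Sum>i\<in>UNIV. eval (\<lambda>j. x $ j) (pdiff i f) * t $ i) = 0"
    if f: "f \<in> vanishing_ideal (toric_model A)" for f
  proof -
    let ?s = "\<lambda>m. \<Sum>i\<in>UNIV. of_nat (lookup m i) * r $ i"
    let ?h = "\<lambda>z. \<Sum>m\<in>keys f. lookup f m * mon_at (\<lambda>i. x $ i) m * exp (z * ?s m)"
    have "?h z = 0" for z
    proof -
      let ?y = "\<chi> i. x $ i * exp (z * r $ i)"
      have "z *s r \<in> row_space A"
        using subspace_row_space r(1) by (rule vec.subspace_scale)
      then have "toric_point A (\<lambda>i. x $ i * exp ((z *s r) $ i))"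
        by (rule toric_point_exp[OF x(1)])
      then have "toric_point A (\<lambda>i. ?y $ i)"
        by simp
      moreover have "?y \<noteq> 0"
        using x(2) by (auto simp: vec_eq_iff)
      ultimately have "proj_class ?y \<in> toric_model A"
        using toric_model_iff[OF hom, of ?y] by blast
      then have "vanishes f (proj_class ?y)"
        using f unfolding vanishing_ideal_def by blast
      then have "eval (\<lambda>i. 1 * ?y $ i) f = 0"
        unfolding vanishes_proj_class[OF \<open>?y \<noteq> 0\<close>] using zero_neq_one by metis
      then show ?thesis
        by (simp add: eval_eq_sum mon_at_mult mon_at_exp sum_distrib_left mult_ac)
    qed
    then have "(?h has_field_derivative 0) (at 0)"
      by simp
    moreover have "(?h has_field_derivative
        (\<Sum>m\<in>keys f. lookup f m * mon_at (\<lambda>i. x $ i) m * ?s m)) (at 0)"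
      by (rule exp_sum_derivative)
    ultimately show ?thesis
      using eval_directional_derivative[of "keys f" f "\<lambda>i. x $ i" "\<lambda>i. r $ i"]
        DERIV_unique[of ?h 0 0] by (simp add: r(2))
  qed
  then show "t \<in> cone_tangent (toric_model A) x"
    by (simp add: cone_tangent_def)
next
  fix t assume t: "t \<in> cone_tangent (toric_model A) x"
  define r where "r = (\<chi> i. t $ i / x $ i)"
  have "r \<in> row_space A"
    unfolding row_space_iff
  proof (intro allI impI)
    fix b assume b: "A *v b = 0"
    obtain v w where vw: "expo v - expo w = b"
      using expo_diff_surj .
    then have vw': "A *v expo v = A *v expo w"
      using b by (metis eq_iff_diff_eq_0 matrix_vector_mult_diff_distrib)
    let ?f = "monomial v - monomial w"
    let ?s = "\<lambda>m. \<Sum>i\<in>UNIV. of_nat (lookup m i) * r $ i"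
    show "(\<Sum>i\<in>UNIV. of_int (b $ i) * r $ i) = 0"
    proof (cases "v = w")
      case True
      then show ?thesis
        using vw by auto
    next
      case False
      have "?f \<in> vanishing_ideal (toric_model A)"
        using toric_ideal_base[OF vw'] by (auto simp: vanishing_ideal_def toric_model_def zero_locus_def)
      then have "0 = (\<Sum>i\<in>UNIV. eval (\<lambda>j. x $ j) (pdiff i ?f) * t $ i)"
        using t by (simp add: cone_tangent_def)
      also have "\<dots> = (\<Sum>i\<in>UNIV. eval (\<lambda>j. x $ j) (pdiff i ?f) * (x $ i * r $ i))"
        using x(2) by (simp add: r_def)
      also have "\<dots> = (\<Sum>m\<in>{v, w}. lookup ?f m * mon_at (\<lambda>j. x $ j) m * ?s m)"
        by (rule eval_directional_derivative)
           (auto simp: in_keys_iff lookup_minus monomial_def lookup_single when_def split: if_splits)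
      also have "\<dots> = mon_at (\<lambda>j. x $ j) v * ?s v - mon_at (\<lambda>j. x $ j) w * ?s w"
        using False by (simp add: lookup_minus monomial_def lookup_single when_def)
      also have "\<dots> = mon_at (\<lambda>j. x $ j) v * (?s v - ?s w)"
        using toric_pointD[OF x(1) vw'] by (simp add: right_diff_distrib)
      finally have "?s v - ?s w = 0"
        using mon_at_nonzero[of "\<lambda>j. x $ j" v] x(2) by simp
      then show ?thesis
        by (simp add: vw[symmetric] expo_def left_diff_distrib sum_subtractf)
    qed
  qed
  moreover have "t = (\<chi> i. x $ i * r $ i)"
    using x(2) by (simp add: r_def vec_eq_iff)
  ultimately show "t \<in> (\<lambda>r. \<chi> i. x $ i * r $ i) ` row_space A"
    by blast
qed

lemma dim_cone_tangent_toric_model: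
  fixes A :: "int^'n::finite^'m::finite"
  assumes "homogeneous_ideal (toric_ideal A)" "toric_point A (\<lambda>i. x $ i)" "\<And>i. x $ i \<noteq> 0"
  shows "vec.dim (cone_tangent (toric_model A) x) = vec.dim (row_space A)"
  unfolding cone_tangent_toric_model[OF assms]
proof (rule vec.dim_image_eq)
  show "Vector_Spaces.linear (*s) (*s) (\<lambda>r. \<chi> i. x $ i * r $ i)"
    by unfold_locales (auto simp: vec_eq_iff algebra_simps)
  show "inj_on (\<lambda>r. \<chi> i. x $ i * r $ i) (vec.span (row_space A))"
    using assms(3) by (auto simp: inj_on_def vec_eq_iff)
qed

section \<open>Closures of subtori\<close>

definition torus_points :: "(complex^'n::finite) set \<Rightarrow> 'n proj set" where
  "torus_points V = (\<lambda>r. proj_class (\<chi> i. exp (r $ i))) ` V"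

definition torus_closure :: "(complex^'n::finite) set \<Rightarrow> 'n proj set" where
  "torus_closure V = zero_locus (vanishing_ideal (torus_points V))"

lemma vec_exp_nonzero [simp]: "(\<chi> i. exp (g i :: complex)) \<noteq> 0"
  by (simp add: vec_eq_iff)

lemma torus_points_subset: "torus_points V \<subseteq> torus_closure V"
  by (auto simp: torus_closure_def zero_locus_def vanishing_ideal_def)

lemma torus_closure_minimal:
  "torus_points V \<subseteq> zero_locus F \<Longrightarrow> torus_closure V \<subseteq> zero_locus F"
  by (auto simp: torus_closure_def zero_locus_def vanishing_ideal_def)

lemma torus_closure_mono: "V \<subseteq> W \<Longrightarrow> torus_closure V \<subseteq> torus_closure W"
  unfolding torus_closure_def[of W]
  by (rule torus_closure_minimal) (auto simp: torus_points_def zero_locus_def vanishing_ideal_def)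

lemma zariski_closed_torus_closure: "zariski_closed (torus_closure V)"
  unfolding torus_closure_def by (rule zariski_closed_zero_locus)

text \<open>Two polynomials not vanishing identically on the torus do not vanish identically on the
  image of a complex line in \<open>V\<close>, where they restrict to entire functions.\<close>

lemma zariski_irreducible_torus_closure:
  fixes V :: "(complex^'n::finite) set"
  assumes V: "vec.subspace V"
  shows "zariski_irreducible (torus_closure V)"
  unfolding zariski_irreducible_def
proof (intro conjI allI impI)
  show "torus_closure V \<noteq> {}"
    using torus_points_subset[of V] vec.subspace_0[OF V] by (auto simp: torus_points_def)
next
  fix Z1 Z2 :: "'n proj set"
  assume Z: "zariski_closed Z1" "zariski_closed Z2" "torus_closure V \<subseteq> Z1 \<union> Z2"
  have separate: "\<exists>f d r. homogeneous d f \<and> (\<forall>x. x \<noteq> 0 \<longrightarrow> proj_class x \<in> Z \<longrightarrow> eval (\<lambda>i. x $ i) f = 0)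
      \<and> r \<in> V \<and> eval (\<lambda>i. exp (r $ i)) f \<noteq> 0"
    if "zariski_closed Z" and not_sub: "\<not> torus_closure V \<subseteq> Z" for Z
  proof -
    obtain F where F: "\<forall>f\<in>F. \<exists>d. homogeneous d f" "Z = zero_locus F"
      using \<open>zariski_closed Z\<close> by (auto simp: zariski_closed_def)
    have "\<not> torus_points V \<subseteq> zero_locus F"
      using torus_closure_minimal[of V F] not_sub F(2) by blast
    then obtain r where r: "r \<in> V" "proj_class (\<chi> i. exp (r $ i)) \<notin> zero_locus F"
      unfolding torus_points_def by blast
    then obtain f where f: "f \<in> F" "\<not> vanishes f (proj_class (\<chi> i. exp (r $ i)))"
      by (auto simp: zero_locus_def)
    then obtain d where d: "homogeneous d f"
      using F by blast
    have "eval (\<lambda>i. exp (r $ i)) f \<noteq> 0"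
      using f(2) vanishes_homogeneous[OF d, of "\<chi> i. exp (r $ i)"] by simp
    moreover have "eval (\<lambda>i. x $ i) f = 0" if "x \<noteq> 0" "proj_class x \<in> Z" for x
    proof -
      have "vanishes f (proj_class x)"
        using that(2) f(1) unfolding F(2) zero_locus_def by blast
      then show ?thesis
        using vanishes_homogeneous[OF d that(1)] by simp
    qed
    ultimately show ?thesis
      using d r(1) by blast
  qed
  show "torus_closure V \<subseteq> Z1 \<or> torus_closure V \<subseteq> Z2"
  proof (rule ccontr)
    assume "\<not> ?thesis"
    then have not_sub: "\<not> torus_closure V \<subseteq> Z1" "\<not> torus_closure V \<subseteq> Z2"
      by auto
    obtain f1 r1 f2 r2 where
      f1: "\<And>x. x \<noteq> 0 \<Longrightarrow> proj_class x \<in> Z1 \<Longrightarrow> eval (\<lambda>i. x $ i) f1 = 0"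
        "r1 \<in> V" "eval (\<lambda>i. exp (r1 $ i)) f1 \<noteq> 0" and
      f2: "\<And>x. x \<noteq> 0 \<Longrightarrow> proj_class x \<in> Z2 \<Longrightarrow> eval (\<lambda>i. x $ i) f2 = 0"
        "r2 \<in> V" "eval (\<lambda>i. exp (r2 $ i)) f2 \<noteq> 0"
      using separate[OF Z(1) not_sub(1)] separate[OF Z(2) not_sub(2)] by blast
    define h where "h f z = eval (\<lambda>i. exp (r1 $ i + z * (r2 $ i - r1 $ i))) f" for f z
    have hol: "h f holomorphic_on UNIV" for f
      unfolding h_def[abs_def] eval_eq_sum mon_at_def by (intro holomorphic_intros)
    have zero: "h f1 z = 0 \<or> h f2 z = 0" for z
    proof -
      let ?r = "r1 + z *s (r2 - r1)"
      have "?r \<in> V"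
        using V f1(2) f2(2) by (intro vec.subspace_add vec.subspace_scale vec.subspace_diff)
      then have "proj_class (\<chi> i. exp (?r $ i)) \<in> Z1 \<union> Z2"
        using Z(3) torus_points_subset[of V] unfolding torus_points_def by blast
      moreover have "h f z = eval (\<lambda>i. (\<chi> i. exp (?r $ i)) $ i) f" for f
        by (simp add: h_def right_diff_distrib)
      ultimately show ?thesis
        using f1(1)[OF vec_exp_nonzero, of "\<lambda>i. ?r $ i"] f2(1)[OF vec_exp_nonzero, of "\<lambda>i. ?r $ i"] by auto
    qed
    define U where "U = {z. h f1 z \<noteq> 0}"
    have "U = h f1 -` (- {0})"
      by (auto simp: U_def)
    then have "open U"
      using continuous_open_preimage[OF holomorphic_on_imp_continuous_on[OF hol, of f1] open_UNIV, of "- {0}"]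
      by (simp add: open_Compl)
    moreover have "0 \<in> U"
      using f1(3) by (simp add: U_def h_def)
    ultimately have "0 islimpt U"
      by (simp add: interior_limit_point interior_open)
    have "h f2 1 = 0"
    proof (rule analytic_continuation[OF hol open_UNIV connected_UNIV subset_UNIV UNIV_I])
      show "0 islimpt U" by fact
      show "h f2 z = 0" if "z \<in> U" for z
        using zero[of z] that unfolding U_def by blast
    qed simp
    then show False
      using f2(3) by (simp add: h_def)
  qed
qed

lemma exp_one_neq_one: "exp (1::complex) \<noteq> 1"
  using exp_of_real[of 1, where 'a = complex] by (simp add: of_real_eq_1_iff del: exp_of_real)

lemma torus_closure_chain:
  fixes V :: "(complex^'n::finite) set"
  assumes "vec.subspace V" "Suc k \<le> vec.dim V"
  shows "\<exists>C. (\<forall>i\<le>k. zariski_closed (C i) \<and> zariski_irreducible (C i) \<and> C i \<subseteq> torus_closure V) \<and>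
             (\<forall>i<k. C i \<subset> C (Suc i))"
  using assms
proof (induction k arbitrary: V)
  case 0
  then show ?case
    using zariski_closed_torus_closure zariski_irreducible_torus_closure
    by (intro exI[of _ "\<lambda>_. torus_closure V"]) auto
next
  case (Suc k)
  have "\<exists>r\<in>V. \<exists>a b. r $ a \<noteq> r $ b"
  proof (rule ccontr)
    assume const: "\<not> ?thesis"
    have "V \<subseteq> vec.span {1}"
    proof
      fix r assume "r \<in> V"
      then have "r = (r $ undefined) *s 1"
        using const by (auto simp: vec_eq_iff)
      then show "r \<in> vec.span {1}"
        by (metis insertI1 vec.span_base vec.span_scale)
    qed
    then have "vec.dim V \<le> 1"
      using vec.dim_le_card[of V "{1}"] by simp
    then show False
      using Suc.prems(2) by simp
  qed
  then obtain r a b where r: "r \<in> V" "r $ a \<noteq> r $ b"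
    by blast
  define W where "W = {s\<in>V. s $ a = s $ b}"
  have W: "vec.subspace W"
    using Suc.prems(1) unfolding W_def vec.subspace_def by auto
  have "V \<subseteq> vec.span (insert r W)"
  proof
    fix s assume "s \<in> V"
    define c where "c = (s $ a - s $ b) / (r $ a - r $ b)"
    have "s - c *s r \<in> V"
      using Suc.prems(1) r(1) \<open>s \<in> V\<close> by (intro vec.subspace_diff vec.subspace_scale)
    moreover have "(s - c *s r) $ a = (s - c *s r) $ b"
      using r(2) by (simp add: c_def field_simps)
    ultimately have "s - c *s r \<in> W"
      by (simp add: W_def)
    then show "s \<in> vec.span (insert r W)"
      by (metis vec.span_breakdown_eq vec.span_base)
  qed
  then have "vec.dim V \<le> vec.dim (insert r W)"
    by (rule vec.dim_mono)
  also have "\<dots> \<le> Suc (vec.dim W)"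
    by (simp add: vec.dim_insert)
  finally have "Suc k \<le> vec.dim W"
    using Suc.prems(2) by simp
  from Suc.IH[OF W this] obtain C where
    C: "\<And>i. i \<le> k \<Longrightarrow> zariski_closed (C i) \<and> zariski_irreducible (C i) \<and> C i \<subseteq> torus_closure W"
      "\<And>i. i < k \<Longrightarrow> C i \<subset> C (Suc i)"
    by blast
  have WV: "torus_closure W \<subseteq> torus_closure V"
    by (rule torus_closure_mono) (auto simp: W_def)
  let ?f = "Var a - Var b :: 'n cpoly"
  define t where "t = (1 / (r $ a - r $ b)) *s r"
  have "t \<in> V"
    using Suc.prems(1) r(1) unfolding t_def by (rule vec.subspace_scale)
  have "exp (t $ a - t $ b) = exp (1::complex)"
    using r(2) by (simp add: t_def divide_simps)
  moreover have "exp (1::complex) \<noteq> 1"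
    by (rule exp_one_neq_one)
  ultimately have "exp (t $ a) \<noteq> exp (t $ b)"
    by (auto simp: exp_diff)
  then have "\<not> vanishes ?f (proj_class (\<chi> i. exp (t $ i)))"
    by (auto simp: vanishes_proj_class)
  moreover have "torus_closure W \<subseteq> zero_locus {?f}"
    by (rule torus_closure_minimal)
       (auto simp: torus_points_def zero_locus_def vanishes_proj_class W_def)
  moreover have "proj_class (\<chi> i. exp (t $ i)) \<in> torus_closure V"
    using torus_points_subset[of V] \<open>t \<in> V\<close> by (auto simp: torus_points_def)
  ultimately have strict: "torus_closure W \<subset> torus_closure V"
    using WV by (auto simp: zero_locus_def)
  define C' where "C' = C(Suc k := torus_closure V)"
  have "zariski_closed (C' i) \<and> zariski_irreducible (C' i) \<and> C' i \<subseteq> torus_closure V"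
    if "i \<le> Suc k" for i
    using C(1)[of i] that WV zariski_closed_torus_closure zariski_irreducible_torus_closure[OF Suc.prems(1)]
    by (auto simp: C'_def le_Suc_eq)
  moreover have "C' i \<subset> C' (Suc i)" if "i < Suc k" for i
    using C(1)[of k] C(2)[of i] that strict by (auto simp: C'_def less_Suc_eq)
  ultimately show ?case
    by blast
qed

section \<open>Algebraic independence along chains\<close>

lemma underdetermined_system:
  fixes F :: "'i \<Rightarrow> 't \<Rightarrow> complex"
  assumes "finite T" "finite I" "card T < card I"
  shows "\<exists>c. (\<exists>i\<in>I. c i \<noteq> 0) \<and> (\<forall>t\<in>T. (\<Sum>i\<in>I. c i * F i t) = 0)"
  using assms
proof (induction T arbitrary: I F rule: finite_induct)
  case empty
  then show ?case
    by (intro exI[of _ "\<lambda>_. 1"]) (auto simp: card_gt_0_iff)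
next
  case (insert t T)
  show ?case
  proof (cases "\<forall>i\<in>I. F i t = 0")
    case True
    moreover have "card T < card I"
      using insert by simp
    ultimately show ?thesis
      using insert.IH[of I F] insert.prems(1) by auto
  next
    case False
    then obtain i0 where i0: "i0 \<in> I" "F i0 t \<noteq> 0"
      by blast
    let ?J = "I - {i0}"
    have "card T < card ?J"
      using insert i0(1) by simp
    with insert.IH[of ?J "\<lambda>i s. F i s - F i t / F i0 t * F i0 s"] insert.prems(1)
    obtain c where c: "\<exists>i\<in>?J. c i \<noteq> 0"
      "\<And>s. s \<in> T \<Longrightarrow> (\<Sum>i\<in>?J. c i * (F i s - F i t / F i0 t * F i0 s)) = 0"
      by auto
    define e where "e = (\<Sum>i\<in>?J. c i * F i t) / F i0 t"
    define c' where "c' = c(i0 := - e)"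
    have split: "(\<Sum>i\<in>I. c' i * F i s) = (\<Sum>i\<in>?J. c i * F i s) - e * F i0 s" for s
      using insert.prems(1) i0(1) by (simp add: sum.remove[of I i0] c'_def)
    have "(\<Sum>i\<in>I. c' i * F i s) = 0" if "s \<in> insert t T" for s
    proof (cases "s = t")
      case True
      then show ?thesis
        unfolding split using i0(2) by (simp add: e_def)
    next
      case False
      then have "0 = (\<Sum>i\<in>?J. c i * (F i s - F i t / F i0 t * F i0 s))"
        using that c(2) by simp
      also have "\<dots> = (\<Sum>i\<in>?J. c i * F i s) - e * F i0 s"
        by (simp add: e_def right_diff_distrib sum_subtractf sum_divide_distrib sum_distrib_right mult.assoc)
      finally show ?thesis
        by (simp add: split)
    qed
    moreover have "\<exists>i\<in>I. c' i \<noteq> 0"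
      using c(1) by (auto simp: c'_def)
    ultimately show ?thesis
      by blast
  qed
qed

lemma power_expansion_zero:
  fixes f :: "'v::finite cpoly"
  assumes f: "\<And>x. x \<in> K \<Longrightarrow> eval x f = 0" and KK: "K \<subseteq> K'"
    and cancel: "\<And>h. (\<forall>x\<in>K'. eval x (f * h) = 0) \<Longrightarrow> \<forall>x\<in>K'. eval x h = 0"
    and g: "\<And>j. \<forall>x\<in>K. eval x (g j) = 0 \<Longrightarrow> g j = 0"
    and sum: "\<forall>x\<in>K'. eval x (\<Sum>j<n. f ^ j * g j) = 0" and "j < n"
  shows "g j = 0"
  using g sum \<open>j < n\<close>
proof (induction n arbitrary: g j)
  case (Suc n)
  have split: "(\<Sum>j<Suc n. f ^ j * g j) = g 0 + f * (\<Sum>j<n. f ^ j * g (Suc j))"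
    by (simp add: sum.lessThan_Suc_shift sum_distrib_left mult.assoc del: sum.lessThan_Suc)
  have "\<forall>x\<in>K. eval x (g 0) = 0"
  proof
    fix x assume "x \<in> K"
    then have "eval x (g 0 + f * (\<Sum>j<n. f ^ j * g (Suc j))) = 0"
      using Suc.prems(2) KK unfolding split by blast
    then show "eval x (g 0) = 0"
      by (simp add: f[OF \<open>x \<in> K\<close>])
  qed
  then have g0: "g 0 = 0"
    by (rule Suc.prems(1))
  then have "\<forall>x\<in>K'. eval x (f * (\<Sum>j<n. f ^ j * g (Suc j))) = 0"
    using Suc.prems(2) unfolding split by simp
  then have "\<forall>x\<in>K'. eval x (\<Sum>j<n. f ^ j * g (Suc j)) = 0"
    by (rule cancel)
  then have "g (Suc j) = 0" if "j < n" for j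
    using Suc.IH[of "\<lambda>j. g (Suc j)"] Suc.prems(1) that by blast
  then show ?case
    using g0 Suc.prems(3) by (cases j) auto
qed simp

lemma box_independent:
  fixes f :: "nat \<Rightarrow> 'v::finite cpoly"
  assumes "K 0 \<noteq> {}" and "\<And>i. i < k \<Longrightarrow> K i \<subseteq> K (Suc i)"
    and "\<And>i x. i < k \<Longrightarrow> x \<in> K i \<Longrightarrow> eval x (f i) = 0"
    and "\<And>i h. i < k \<Longrightarrow> \<forall>x\<in>K (Suc i). eval x (f i * h) = 0 \<Longrightarrow> \<forall>x\<in>K (Suc i). eval x h = 0"
    and "\<forall>x\<in>K k. eval x (\<Sum>a\<in>{..<k} \<rightarrow>\<^sub>E {..D}. Const (c a) * (\<Prod>i<k. f i ^ a i)) = 0"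
    and "a \<in> {..<k} \<rightarrow>\<^sub>E {..D}"
  shows "c a = 0"
  using assms
proof (induction k arbitrary: c a)
  case 0
  then show ?case
    by (auto simp: PiE_empty_domain)
next
  case (Suc k)
  let ?G = "\<lambda>c. \<Sum>a\<in>{..<k} \<rightarrow>\<^sub>E {..D}. Const (c a) * (\<Prod>i<k. f i ^ a i)"
  have IH: "c a = 0" if "\<forall>x\<in>K k. eval x (?G c) = 0" "a \<in> {..<k} \<rightarrow>\<^sub>E {..D}" for c a
  proof (rule Suc.IH[where c = c])
    show "K i \<subseteq> K (Suc i)" if "i < k" for i
      using that by (intro Suc.prems(2)) simp
    show "eval x (f i) = 0" if "i < k" "x \<in> K i" for i x
      using that by (intro Suc.prems(3)) simp_all
    show "\<forall>x\<in>K (Suc i). eval x h = 0" if "i < k" "\<forall>x\<in>K (Suc i). eval x (f i * h) = 0" for i h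
      by (rule Suc.prems(4)[OF less_SucI[OF that(1)] that(2)])
  qed fact+
  have inj: "inj_on (\<lambda>(j, a). a(k := j)) ({..D} \<times> ({..<k} \<rightarrow>\<^sub>E {..D}))"
    by (rule inj_combinator) simp
  have image: "{..<Suc k} \<rightarrow>\<^sub>E {..D} = (\<lambda>(j, a). a(k := j)) ` ({..D} \<times> ({..<k} \<rightarrow>\<^sub>E {..D}))"
    unfolding lessThan_Suc PiE_insert_eq ..
  have "(\<Sum>a\<in>{..<Suc k} \<rightarrow>\<^sub>E {..D}. Const (c a) * (\<Prod>i<Suc k. f i ^ a i)) =
      (\<Sum>(j, a)\<in>{..D} \<times> ({..<k} \<rightarrow>\<^sub>E {..D}).
        Const (c (a(k := j))) * (\<Prod>i<Suc k. f i ^ (a(k := j)) i))"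
    unfolding image sum.reindex[OF inj] by (simp only: o_def case_prod_unfold)
  also have "\<dots> = (\<Sum>j\<le>D. \<Sum>a\<in>{..<k} \<rightarrow>\<^sub>E {..D}. Const (c (a(k := j))) * (f k ^ j * (\<Prod>i<k. f i ^ a i)))"
    by (subst sum.cartesian_product[symmetric]) (simp add: mult.commute)
  also have "\<dots> = (\<Sum>j<Suc D. f k ^ j * ?G (\<lambda>a. c (a(k := j))))"
    by (simp add: lessThan_Suc_atMost sum_distrib_left mult.left_commute)
  finally have expand: "\<forall>x\<in>K (Suc k). eval x (\<Sum>j<Suc D. f k ^ j * ?G (\<lambda>a. c (a(k := j)))) = 0"
    using Suc.prems(5) by simp
  have "?G (\<lambda>a. c (a(k := j))) = 0" if "j < Suc D" for j
  proof (rule power_expansion_zero[where K = "K k" and K' = "K (Suc k)" and f = "f k" and n = "Suc D"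
        and g = "\<lambda>j. ?G (\<lambda>a. c (a(k := j)))"])
    fix j assume "\<forall>x\<in>K k. eval x (?G (\<lambda>a. c (a(k := j)))) = 0"
    then have "c (a(k := j)) = 0" if "a \<in> {..<k} \<rightarrow>\<^sub>E {..D}" for a
      using IH[of "\<lambda>a. c (a(k := j))"] that by blast
    then show "?G (\<lambda>a. c (a(k := j))) = 0"
      by (simp add: Const_def)
  next
    show "\<forall>x\<in>K (Suc k). eval x h = 0" if "\<forall>x\<in>K (Suc k). eval x (f k * h) = 0" for h
      by (rule Suc.prems(4)[OF lessI that])
  qed (use Suc.prems(2,3) expand that in auto)
  then have "c (b(k := j)) = 0" if "j \<le> D" "b \<in> {..<k} \<rightarrow>\<^sub>E {..D}" for j b
    using IH[of "\<lambda>a. c (a(k := j))" b] that by simp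
  moreover obtain j b where "j \<le> D" "b \<in> {..<k} \<rightarrow>\<^sub>E {..D}" "a = b(k := j)"
    using Suc.prems(6) unfolding image by auto
  ultimately show ?case
    by blast
qed

section \<open>The dimension of the toric model\<close>

lemma row_space_eq_span:
  "row_space A = vec.span (range (\<lambda>k. \<chi> j. of_int (A $ k $ j)))"
proof
  show "vec.span (range (\<lambda>k. \<chi> j. of_int (A $ k $ j))) \<subseteq> row_space A"
  proof (rule vec.span_minimal[OF _ subspace_row_space], rule image_subsetI)
    fix k
    have "(\<chi> j. of_int (A $ k $ j)) =
        (\<chi> j. \<Sum>l\<in>UNIV. (if l = k then 1 else 0) * complex_of_int (A $ l $ j))"
      by (simp add: if_distrib[of "\<lambda>z. z * _"] cong: if_cong)
    then show "(\<chi> j. of_int (A $ k $ j)) \<in> row_space A"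
      unfolding row_space_def by (intro CollectI exI conjI TrueI)
  qed
  show "row_space A \<subseteq> vec.span (range (\<lambda>k. \<chi> j. of_int (A $ k $ j)))"
  proof
    fix r assume "r \<in> row_space A"
    then obtain \<theta> where "r = (\<chi> j. \<Sum>k\<in>UNIV. \<theta> k * of_int (A $ k $ j))"
      by (auto simp: row_space_def)
    then have "r = (\<Sum>k\<in>UNIV. \<theta> k *s (\<chi> j. of_int (A $ k $ j)))"
      by (simp add: vec_eq_iff)
    also have "\<dots> \<in> vec.span (range (\<lambda>k. \<chi> j. of_int (A $ k $ j)))"
      by (intro vec.span_sum vec.span_scale vec.span_base) auto
    finally show "r \<in> vec.span (range (\<lambda>k. \<chi> j. of_int (A $ k $ j)))" .
  qed
qed

lemma finite_weight_le: "finite {m :: 'v::finite \<Rightarrow>\<^sub>0 nat. weight (\<lambda>_. 1) m \<le> E}"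
proof (rule finite_imageD)
  have le: "lookup m i \<le> weight (\<lambda>_. 1) m" for m :: "'v \<Rightarrow>\<^sub>0 nat" and i
    unfolding weight_def using member_le_sum[of i UNIV "lookup m"] by simp
  have "lookup ` {m :: 'v \<Rightarrow>\<^sub>0 nat. weight (\<lambda>_. 1) m \<le> E} \<subseteq> UNIV \<rightarrow>\<^sub>E {..E}"
  proof (rule image_subsetI)
    fix m :: "'v \<Rightarrow>\<^sub>0 nat" assume "m \<in> {m. weight (\<lambda>_. 1) m \<le> E}"
    then have "lookup m i \<le> E" for i
      using le[of m i] by simp
    then show "lookup m \<in> UNIV \<rightarrow>\<^sub>E {..E}"
      by (simp add: PiE_iff)
  qed
  then show "finite (lookup ` {m :: 'v \<Rightarrow>\<^sub>0 nat. weight (\<lambda>_. 1) m \<le> E})"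
    by (rule finite_subset) (auto intro: finite_PiE)
  show "inj_on lookup {m :: 'v \<Rightarrow>\<^sub>0 nat. weight (\<lambda>_. 1) m \<le> E}"
    by (auto intro!: inj_onI)
qed

text \<open>The values \<open>A v\<close> are determined by \<open>dim (row_space A)\<close> of their coordinates, each of
  which is bounded linearly in the degree.\<close>

lemma card_toric_degrees:
  fixes A :: "int^'n::finite^'m::finite"
  obtains c :: nat where
    "\<And>E. card ((\<lambda>m. A *v expo m) ` {m. weight (\<lambda>_. 1) m \<le> E}) \<le> (2 * c * E + 1) ^ vec.dim (row_space A)"
proof -
  let ?row = "\<lambda>k. (\<chi> j. of_int (A $ k $ j)) :: complex^'n"
  obtain B where B: "B \<subseteq> range ?row" "vec.independent B" "range ?row \<subseteq> vec.span B"
      "card B = vec.dim (range ?row)"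
    using vec.basis_exists by blast
  obtain K where K: "inj_on ?row K" "B = ?row ` K"
    using B(1) by (auto simp: subset_image_inj)
  have cardK: "card K = vec.dim (row_space A)"
    using B(4) K by (simp add: row_space_eq_span card_image)
  define c where "c = Max (range (\<lambda>(k, j). nat \<bar>A $ k $ j\<bar>))"
  have c: "\<bar>A $ k $ j\<bar> \<le> int c" for k j
  proof -
    have "nat \<bar>A $ k $ j\<bar> \<le> c"
      unfolding c_def by (rule Max_ge) auto
    then show ?thesis by simp
  qed
  have "card ((\<lambda>m. A *v expo m) ` {m. weight (\<lambda>_. 1) m \<le> E}) \<le> (2 * c * E + 1) ^ vec.dim (row_space A)" for E
  proof -
    let ?T = "(\<lambda>m. A *v expo m) ` {m. weight (\<lambda>_. 1) m \<le> E}"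
    let ?box = "K \<rightarrow>\<^sub>E {- int (c * E)..int (c * E)}"
    let ?\<Phi> = "\<lambda>y. restrict (\<lambda>k. y $ k) K"
    have inj: "inj_on ?\<Phi> ?T"
    proof (rule inj_onI)
      fix y z assume yz: "y \<in> ?T" "z \<in> ?T" "?\<Phi> y = ?\<Phi> z"
      then obtain v w where vw: "y = A *v expo v" "z = A *v expo w"
        by blast
      define e where "e = expo v - expo w"
      let ?L = "{r. (\<Sum>j\<in>UNIV. r $ j * of_int (e $ j)) = (0::complex)}"
      have L: "?row k \<in> ?L \<longleftrightarrow> y $ k = z $ k" for k
      proof -
        have "(\<Sum>j\<in>UNIV. ?row k $ j * of_int (e $ j)) = complex_of_int (\<Sum>j\<in>UNIV. A $ k $ j * e $ j)"
          by simp
        also have "(\<Sum>j\<in>UNIV. A $ k $ j * e $ j) = y $ k - z $ k"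
          by (simp add: vw e_def matrix_vector_mult_def right_diff_distrib sum_subtractf)
        finally show ?thesis
          by simp
      qed
      have "vec.subspace ?L"
        unfolding vec.subspace_def
        by (auto simp: distrib_right sum.distrib mult.assoc simp flip: sum_distrib_left)
      moreover have "B \<subseteq> ?L"
      proof
        fix r assume "r \<in> B"
        then obtain k where k: "k \<in> K" "r = ?row k"
          using K by blast
        then have "y $ k = z $ k"
          using yz(3) by (metis restrict_apply')
        then show "r \<in> ?L"
          using L[of k] k by blast
      qed
      ultimately have "vec.span B \<subseteq> ?L"
        using vec.span_minimal by blast
      then have "?row k \<in> ?L" for k
        using B(3) by blast
      then show "y = z"
        using L by (simp add: vec_eq_iff)
    qed
    have "?\<Phi> ` ?T \<subseteq> ?box"
    proof (rule image_subsetI)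
      fix y assume "y \<in> ?T"
      then obtain m where m: "weight (\<lambda>_. 1) m \<le> E" "y = A *v expo m"
        by blast
      have "\<bar>y $ k\<bar> \<le> int (c * E)" for k
      proof -
        have "\<bar>y $ k\<bar> \<le> (\<Sum>j\<in>UNIV. \<bar>A $ k $ j * int (lookup m j)\<bar>)"
          unfolding m(2) matrix_vector_mult_def expo_def by simp
        also have "\<dots> \<le> (\<Sum>j\<in>UNIV. int c * int (lookup m j))"
          by (intro sum_mono) (simp add: abs_mult mult_right_mono c)
        also have "\<dots> = int (c * weight (\<lambda>_. 1) m)"
          by (simp add: weight_def sum_distrib_left)
        also have "\<dots> \<le> int (c * E)"
          using m(1) by (simp only: of_nat_le_iff mult_le_mono2)
        finally show ?thesis .
      qed
      then have "y $ k \<in> {- int (c * E)..int (c * E)}" for k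
        using abs_le_D1 abs_le_D2 minus_le_iff by (metis atLeastAtMost_iff)
      then show "?\<Phi> y \<in> ?box"
        by (intro restrict_PiE_iff[THEN iffD2] ballI)
    qed
    then have "card ?T \<le> card ?box"
      by (intro card_inj_on_le[OF inj] finite_PiE) auto
    also have "\<dots> = (2 * c * E + 1) ^ card K"
    proof -
      have "nat (int (c * E) + 1 - - int (c * E)) = 2 * c * E + 1"
        by (simp add: nat_eq_iff)
      then show ?thesis
        by (simp add: card_PiE)
    qed
    finally show ?thesis
      by (simp add: cardK)
  qed
  then show ?thesis
    using that by blast
qed

lemma homogeneous_prod_powers:
  fixes f :: "nat \<Rightarrow> 'v::finite cpoly"
  assumes "\<And>i. i < k \<Longrightarrow> homogeneous (d i) (f i)"
  shows "homogeneous (\<Sum>i<k. d i * a i) (\<Prod>i<k. f i ^ a i)"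
proof -
  have one: "homogeneous 0 (1 :: 'v cpoly)"
    by (simp add: homogeneous_iff_weight weight_def)
  have mult: "homogeneous (b + c) (g * h)" if "homogeneous b g" "homogeneous c h" for b c and g h :: "'v cpoly"
    using that keys_mult[of g h]
    by (fastforce simp: homogeneous_iff_weight weight_def lookup_add sum.distrib)
  have pow: "homogeneous (b * n) (g ^ n)" if "homogeneous b g" for b n and g :: "'v cpoly"
    by (induction n) (use one mult that in auto)
  show ?thesis
    using assms by (induction k) (auto simp: one intro!: mult pow)
qed

lemma polynomial_growth:
  fixes k d c :: nat
  assumes "\<And>D. (D + 1) ^ k \<le> (c * D + 1) ^ d"
  shows "k \<le> d"
proof (rule ccontr)
  assume "\<not> k \<le> d"
  define D where "D = (c + 1) ^ d"
  have "(D + 1) * (D + 1) ^ d \<le> (D + 1) ^ k"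
    using \<open>\<not> k \<le> d\<close> power_increasing[of "Suc d" k "D + 1"] by simp
  also have "\<dots> \<le> (c * D + 1) ^ d"
    by (rule assms)
  also have "\<dots> \<le> ((c + 1) * (D + 1)) ^ d"
    by (rule power_mono) auto
  also have "\<dots> = D * (D + 1) ^ d"
    unfolding power_mult_distrib D_def ..
  finally show False
    by simp
qed

lemma toric_model_chain_length:
  fixes A :: "int^'n::finite^'m::finite" and C :: "nat \<Rightarrow> 'n proj set"
  assumes hom: "homogeneous_ideal (toric_ideal A)"
    and C: "\<And>i. i \<le> k \<Longrightarrow> zariski_closed (C i) \<and> zariski_irreducible (C i) \<and> C i \<subseteq> toric_model A"
    and strict: "\<And>i. i < k \<Longrightarrow> C i \<subset> C (Suc i)"
  shows "Suc k \<le> vec.dim (row_space A)"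
proof -
  define K :: "nat \<Rightarrow> ('n \<Rightarrow> complex) set" where
    "K i = ($) ` (case i of 0 \<Rightarrow> {0} | Suc i \<Rightarrow> {x. x = 0 \<or> proj_class x \<in> C i})" for i
  have K_Suc: "K (Suc i) = ($) ` {x. x = 0 \<or> proj_class x \<in> C i}" and K_0: "K 0 = {\<lambda>_. 0}" for i
    by (auto simp: K_def fun_eq_iff)
  have nonempty: "\<exists>x. x \<noteq> 0 \<and> proj_class x \<in> C i" if "i \<le> k" for i
    using C[OF that] proj_exhaust unfolding zariski_irreducible_def by (metis ex_in_conv)
  have "\<exists>f d. homogeneous d f \<and> (\<forall>x\<in>K i. eval x f = 0) \<and> \<not> C i \<subseteq> zero_locus {f}"
    if "i < Suc k" for i
  proof (cases i)
    case 0
    obtain x where x: "x \<noteq> 0" "proj_class x \<in> C 0"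
      using nonempty[of 0] by blast
    then obtain j where j: "x $ j \<noteq> 0"
      by (auto simp: vec_eq_iff)
    have hV: "homogeneous 1 (Var j :: 'n cpoly)"
      by (auto simp: homogeneous_iff_weight weight_def Var_def monomial_def lookup_single when_def)
    have "\<not> vanishes (Var j) (proj_class x)"
      using vanishes_homogeneous[OF hV x(1)] j by simp
    then have "\<not> C i \<subseteq> zero_locus {Var j}"
      using x(2) 0 by (auto simp: zero_locus_def)
    then show ?thesis
      using hV 0 by (intro exI[of _ "Var j"] exI[of _ 1]) (auto simp: K_0)
  next
    case (Suc l)
    then have l: "l < k" "l \<le> k"
      using that by auto
    obtain F where F: "\<forall>f\<in>F. \<exists>d. homogeneous d f" "C l = zero_locus F"
      using C[OF l(2)] by (auto simp: zariski_closed_def)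
    then obtain X f where X: "X \<in> C i" "f \<in> F" "\<not> vanishes f X"
      using strict[OF l(1)] Suc by (auto simp: zero_locus_def)
    then obtain d where d: "homogeneous d f"
      using F by blast
    have f0: "eval (\<lambda>i. x $ i) f = 0" if "x \<noteq> 0" "proj_class x \<in> C l" for x
    proof -
      have "vanishes f (proj_class x)"
        using that(2) X(2) unfolding F(2) zero_locus_def by blast
      then show ?thesis
        using vanishes_homogeneous[OF d that(1)] by simp
    qed
    obtain y where "y \<noteq> 0" "proj_class y \<in> C l"
      using nonempty l by blast
    then have "eval (\<lambda>i. 0 * y $ i) f = 0"
      using eval_homogeneous_scale[OF d, of 0 "\<lambda>i. y $ i"] f0 by simp
    then have "eval (\<lambda>i. x $ i) f = 0" if "x = 0 \<or> proj_class x \<in> C l" for x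
      using f0[of x] that by (cases "x = 0") auto
    then have "\<forall>x\<in>K i. eval x f = 0"
      unfolding Suc K_Suc by blast
    then show ?thesis
      using d X(1,3) by (intro exI[of _ f] exI[of _ d]) (auto simp: zero_locus_def)
  qed
  then obtain f d where
    f: "\<And>i. i < Suc k \<Longrightarrow> homogeneous (d i) (f i)" "\<And>i x. i < Suc k \<Longrightarrow> x \<in> K i \<Longrightarrow> eval x (f i) = 0"
      "\<And>i. i < Suc k \<Longrightarrow> \<not> C i \<subseteq> zero_locus {f i}"
    by metis
  have K_mono: "K i \<subseteq> K (Suc i)" if "i < Suc k" for i
  proof (cases i)
    case 0
    then show ?thesis
      by (auto simp: K_0 K_Suc image_iff fun_eq_iff intro!: exI[of _ 0])
  next
    case (Suc l)
    then show ?thesis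
      using strict[of l] that by (auto simp: K_Suc)
  qed
  have cancel: "\<forall>x\<in>K (Suc i). eval x h = 0"
    if i: "i < Suc k" and fh: "\<forall>x\<in>K (Suc i). eval x (f i * h) = 0" for i h
  proof -
    have nz: "eval (\<lambda>j. x $ j) h = 0" if "x \<noteq> 0" "proj_class x \<in> C i" for x
    proof (rule irreducible_mult_zero[OF _ f(1)[OF i] f(3)[OF i] _ that])
      show "zariski_irreducible (C i)"
        using C i by auto
      show "eval (\<lambda>j. x $ j) (f i * h) = 0" if "x \<noteq> 0" "proj_class x \<in> C i" for x
        using fh that unfolding K_Suc by blast
    qed
    obtain y where y: "y \<noteq> 0" "proj_class y \<in> C i"
      using nonempty i by (auto simp: less_Suc_eq_le)
    have "eval (\<lambda>j. 0 $ j) h = 0"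
    proof (rule eval_zero_limit[where b = "\<lambda>j. y $ j"])
      fix c :: complex assume "c \<noteq> 0"
      then have "c *s y \<noteq> 0" "proj_class (c *s y) = proj_class y"
        using y(1) coords_proj_class[OF y(1)] by (auto simp: coords_def)
      then show "eval (\<lambda>j. 0 $ j + c * y $ j) h = 0"
        using nz[of "c *s y"] y(2) by simp
    qed
    then have "eval (\<lambda>j. x $ j) h = 0" if "x = 0 \<or> proj_class x \<in> C i" for x
      using nz[of x] that by (cases "x = 0") auto
    then show ?thesis
      unfolding K_Suc by blast
  qed
  have toric: "toric_point A x" if xK: "x \<in> K (Suc k)" for x
  proof -
    obtain y where y: "x = (\<lambda>i. y $ i)" "y = 0 \<or> proj_class y \<in> C k"
      using xK unfolding K_Suc by blast
    show ?thesis
    proof (cases "y = 0")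
      case True
      then show ?thesis
        using toric_point_scale[OF hom toric_point_one, of 0] y(1) by simp
    next
      case False
      then show ?thesis
        using toric_model_iff[OF hom, of y] C[of k] y by blast
    qed
  qed
  obtain c where c: "\<And>E. card ((\<lambda>m. A *v expo m) ` {m. weight (\<lambda>_. 1) m \<le> E}) \<le> (2 * c * E + 1) ^ vec.dim (row_space A)"
    using card_toric_degrees by blast
  define e where "e = (\<Sum>i<Suc k. d i)"
  have "(D + 1) ^ Suc k \<le> (2 * c * e * D + 1) ^ vec.dim (row_space A)" for D
  proof (rule ccontr)
    let ?I = "{..<Suc k} \<rightarrow>\<^sub>E {..D}"
    let ?F = "\<lambda>a. \<Prod>i<Suc k. f i ^ a i"
    let ?S = "{m. weight (\<lambda>_. 1) m \<le> e * D}"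
    let ?T = "(\<lambda>m. A *v expo m) ` ?S"
    let ?coef = "\<lambda>a t. \<Sum>m\<in>{m\<in>?S. A *v expo m = t}. lookup (?F a) m"
    assume "\<not> ?thesis"
    moreover have "card ?I = (D + 1) ^ Suc k"
      by (simp add: card_PiE)
    ultimately have "card ?T < card ?I"
      using c[of "e * D"] by (simp add: mult.assoc)
    moreover have "finite ?T" "finite ?I"
      by (intro finite_imageI finite_weight_le) (intro finite_PiE; simp)
    ultimately have "\<exists>b. (\<exists>a\<in>?I. b a \<noteq> 0) \<and> (\<forall>t\<in>?T. (\<Sum>a\<in>?I. b a * ?coef a t) = 0)"
      by (intro underdetermined_system)
    then obtain b where b: "\<exists>a\<in>?I. b a \<noteq> 0" "\<And>t. t \<in> ?T \<Longrightarrow> (\<Sum>a\<in>?I. b a * ?coef a t) = 0"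
      by blast
    have "eval x (\<Sum>a\<in>?I. Const (b a) * ?F a) = 0" if xK: "x \<in> K (Suc k)" for x
    proof -
      define val where "val t = mon_at x (SOME m. A *v expo m = t)" for t
      have val: "mon_at x m = val (A *v expo m)" for m
      proof -
        have "A *v expo (SOME m'. A *v expo m' = A *v expo m) = A *v expo m"
          by (rule someI) (rule refl)
        then show ?thesis
          unfolding val_def by (intro toric_pointD[OF toric[OF xK]]) (rule sym)
      qed
      have "eval x (?F a) = (\<Sum>t\<in>?T. ?coef a t * val t)" if a: "a \<in> ?I" for a
      proof -
        have "(\<Sum>i<Suc k. d i * a i) \<le> (\<Sum>i<Suc k. d i * D)"
          using a by (intro sum_mono mult_le_mono2) auto
        also have "\<dots> = e * D"
          unfolding e_def by (rule sum_distrib_right[symmetric])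
        finally have "(\<Sum>i<Suc k. d i * a i) \<le> e * D" .
        moreover have "homogeneous (\<Sum>i<Suc k. d i * a i) (?F a)"
          using f(1) by (rule homogeneous_prod_powers)
        ultimately have "keys (?F a) \<subseteq> ?S"
          unfolding homogeneous_iff_weight by (simp only: subset_eq mem_Collect_eq) metis
        then have "eval x (?F a) = (\<Sum>m\<in>?S. lookup (?F a) m * val (A *v expo m))"
          unfolding val[symmetric] by (rule eval_superset[OF finite_weight_le])
        also have "\<dots> = (\<Sum>t\<in>?T. \<Sum>m\<in>{m\<in>?S. A *v expo m = t}. lookup (?F a) m * val (A *v expo m))"
          by (rule sum.image_gen[OF finite_weight_le])
        also have "\<dots> = (\<Sum>t\<in>?T. ?coef a t * val t)"
          by (simp add: sum_distrib_right)
        finally show ?thesis .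
      qed
      then have "eval x (\<Sum>a\<in>?I. Const (b a) * ?F a) = (\<Sum>a\<in>?I. b a * (\<Sum>t\<in>?T. ?coef a t * val t))"
        by (simp only: eval_sum eval_mult eval_Const cong: sum.cong)
      also have "\<dots> = (\<Sum>t\<in>?T. (\<Sum>a\<in>?I. b a * ?coef a t) * val t)"
        unfolding sum_distrib_left sum_distrib_right mult.assoc by (rule sum.swap)
      also have "\<dots> = 0"
        using b(2) by simp
      finally show ?thesis .
    qed
    then have zero: "\<forall>x\<in>K (Suc k). eval x (\<Sum>a\<in>?I. Const (b a) * ?F a) = 0"
      by blast
    have "b a = 0" if a: "a \<in> ?I" for a
      by (rule box_independent[where K = K and f = f, OF _ K_mono f(2) cancel zero a])
         (simp add: K_0)
    then show False
      using b(1) by blast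
  qed
  then show ?thesis
    by (rule polynomial_growth)
qed

lemma torus_closure_subset_toric_model:
  assumes "homogeneous_ideal (toric_ideal A)"
  shows "torus_closure (row_space A) \<subseteq> toric_model A"
  unfolding toric_model_def
proof (rule torus_closure_minimal, fold toric_model_def)
  show "torus_points (row_space A) \<subseteq> toric_model A"
    using toric_point_exp[OF toric_point_one] toric_model_iff[OF assms]
    by (auto simp: torus_points_def)
qed

lemma zariski_dim_toric_model:
  fixes A :: "int^'n::finite^'m::finite"
  assumes hom: "homogeneous_ideal (toric_ideal A)"
  shows "zariski_dim (toric_model A) + 1 = enat (vec.dim (row_space A))"
proof -
  let ?d = "vec.dim (row_space A)"
  have "(1 :: complex^'n) \<noteq> 0"
    by (simp add: vec_eq_iff)
  then have "?d \<noteq> 0"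
    using one_in_row_space[OF hom] by (auto simp: vec.dim_eq_0)
  then obtain e where e: "?d = Suc e"
    by (cases ?d) auto
  have "zariski_dim (toric_model A) = enat e"
    unfolding zariski_dim_def
  proof (rule antisym)
    obtain C where "\<forall>i\<le>e. zariski_closed (C i) \<and> zariski_irreducible (C i) \<and> C i \<subseteq> torus_closure (row_space A)"
        "\<forall>i<e. C i \<subset> C (Suc i)"
      using torus_closure_chain[OF subspace_row_space, of e A] e by auto
    then show "enat e \<le> Sup {enat k |k. \<exists>C. (\<forall>i\<le>k. zariski_closed (C i) \<and>
        zariski_irreducible (C i) \<and> C i \<subseteq> toric_model A) \<and> (\<forall>i<k. C i \<subset> C (Suc i))}"
      using torus_closure_subset_toric_model[OF hom] by (intro Sup_upper) blast
    show "Sup {enat k |k. \<exists>C. (\<forall>i\<le>k. zariski_closed (C i) \<and>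
        zariski_irreducible (C i) \<and> C i \<subseteq> toric_model A) \<and> (\<forall>i<k. C i \<subset> C (Suc i))} \<le> enat e"
    proof (rule Sup_least, clarify)
      fix k C assume "\<forall>i\<le>k. zariski_closed (C i) \<and> zariski_irreducible (C i) \<and> C i \<subseteq> toric_model A"
        "\<forall>i<k. C i \<subset> C (Suc i)"
      then have "Suc k \<le> ?d"
        by (intro toric_model_chain_length[OF hom, of k C]) auto
      then show "enat k \<le> enat e"
        using e by simp
    qed
  qed
  then show ?thesis
    by (simp add: e one_enat_def)
qed

lemma torus_point_smooth:
  assumes hom: "homogeneous_ideal (toric_ideal A)"
    and x: "toric_point A (\<lambda>i. x $ i)" "\<And>i. x $ i \<noteq> 0"
  shows "proj_class x \<in> smooth_locus (toric_model A)"
  unfolding smooth_locus_def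
proof (intro CollectI conjI ballI)
  have "x \<noteq> 0"
    using x(2) by (auto simp: vec_eq_iff)
  then show "proj_class x \<in> toric_model A"
    using toric_model_iff[OF hom] x(1) by blast
  fix y assume "y \<in> coords (proj_class x)"
  then obtain c where c: "c \<noteq> 0" "y = c *s x"
    using coords_proj_class[OF \<open>x \<noteq> 0\<close>] by blast
  then have "toric_point A (\<lambda>i. y $ i)"
    using toric_point_scale[OF hom x(1), of c] by simp
  moreover have "y $ i \<noteq> 0" for i
    using c x(2) by simp
  ultimately show "enat (vec.dim (cone_tangent (toric_model A) y)) = zariski_dim (toric_model A) + 1"
    by (simp add: dim_cone_tangent_toric_model[OF hom] zariski_dim_toric_model[OF hom])
qed

section \<open>Polynomials vanishing on a torus\<close>

definition torus_char :: "int^'m::finite \<Rightarrow> ('m \<Rightarrow> complex) \<Rightarrow> complex" where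
  "torus_char b \<theta> = exp (\<Sum>k\<in>UNIV. \<theta> k * of_int (b $ k))"

lemma torus_char_add: "torus_char b (\<lambda>k. \<theta> k + \<eta> k) = torus_char b \<theta> * torus_char b \<eta>"
  by (simp add: torus_char_def distrib_right sum.distrib exp_add)

lemma torus_char_separates:
  assumes "b \<noteq> b'"
  obtains \<theta> where "torus_char b \<theta> \<noteq> torus_char b' \<theta>"
proof -
  obtain k where k: "b $ k \<noteq> b' $ k"
    using assms by (auto simp: vec_eq_iff)
  define \<theta> where "\<theta> l = (if l = k then 1 / of_int (b $ k - b' $ k) else 0 :: complex)" for l
  have char: "torus_char c \<theta> = exp (of_int (c $ k) / of_int (b $ k - b' $ k))" for c
    by (simp add: torus_char_def \<theta>_def if_distrib[of "\<lambda>z. z * _"] cong: if_cong)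
  have "of_int (b $ k) - of_int (b' $ k) \<noteq> (0::complex)"
    using k by simp
  then have "torus_char b \<theta> / torus_char b' \<theta> = exp (1::complex)"
    unfolding char exp_diff[symmetric] diff_divide_distrib[symmetric] by simp
  moreover have "exp (1::complex) \<noteq> 1"
    by (rule exp_one_neq_one)
  ultimately have "torus_char b \<theta> \<noteq> torus_char b' \<theta>"
    by (auto simp: char)
  then show ?thesis
    by (rule that)
qed

text \<open>Dedekind's argument: shifting the argument and subtracting eliminates one character.\<close>

lemma torus_chars_independent:
  assumes "finite S" "\<And>\<theta>. (\<Sum>b\<in>S. c b * torus_char b \<theta>) = 0" "b \<in> S"
  shows "c b = 0"
  using assms
proof (induction S arbitrary: c b rule: finite_induct)
  case (insert a S)
  have zero: "c b = 0" if "b \<in> S" for b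
  proof -
    have "b \<noteq> a"
      using that insert.hyps(2) by blast
    then obtain \<eta> where \<eta>: "torus_char b \<eta> \<noteq> torus_char a \<eta>"
      by (rule torus_char_separates)
    have "(\<Sum>b\<in>S. (c b * (torus_char b \<eta> - torus_char a \<eta>)) * torus_char b \<theta>) = 0" for \<theta>
    proof -
      have "(\<Sum>b\<in>insert a S. c b * torus_char b (\<lambda>k. \<theta> k + \<eta> k))
          - torus_char a \<eta> * (\<Sum>b\<in>insert a S. c b * torus_char b \<theta>) = 0"
        unfolding insert.prems(1) by simp
      moreover have "(\<Sum>b\<in>insert a S. c b * torus_char b (\<lambda>k. \<theta> k + \<eta> k))
          - torus_char a \<eta> * (\<Sum>b\<in>insert a S. c b * torus_char b \<theta>)
          = (\<Sum>b\<in>insert a S. (c b * (torus_char b \<eta> - torus_char a \<eta>)) * torus_char b \<theta>)"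
        unfolding sum_distrib_left sum_subtractf[symmetric]
        by (intro sum.cong) (auto simp: torus_char_add algebra_simps)
      ultimately show ?thesis
        using insert.hyps by simp
    qed
    then have "c b * (torus_char b \<eta> - torus_char a \<eta>) = 0"
      using insert.IH[of "\<lambda>b. c b * (torus_char b \<eta> - torus_char a \<eta>)" b] that by blast
    then show ?thesis
      using \<eta> by simp
  qed
  then have "c a * torus_char a (\<lambda>_. 0) = 0"
    using insert.prems(1)[of "\<lambda>_. 0"] insert.hyps by simp
  then have "c a = 0"
    by (simp add: torus_char_def)
  then show ?case
    using zero insert.prems(2) by blast
qed simp

lemma Const_sum: "Const (\<Sum>i\<in>I. g i) = (\<Sum>i\<in>I. Const (g i))"
  by (induction I rule: infinite_finite_induct) (auto simp: Const_def single_add)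

lemma toric_ideal_if_vanishing_on_torus:
  fixes A :: "int^'v::finite^'m::finite"
  assumes "\<And>r. r \<in> row_space A \<Longrightarrow> eval (\<lambda>i. exp (r $ i)) f = 0"
  shows "f \<in> toric_ideal A"
proof -
  let ?cls = "\<lambda>m. A *v expo m"
  let ?T = "?cls ` keys f"
  let ?fib = "\<lambda>t. {m\<in>keys f. ?cls m = t}"
  have coef: "(\<Sum>m\<in>?fib t. lookup f m) = 0" if "t \<in> ?T" for t
  proof (rule torus_chars_independent[of ?T "\<lambda>t. \<Sum>m\<in>?fib t. lookup f m"])
    fix \<theta> :: "'m \<Rightarrow> complex"
    let ?r = "\<chi> j. \<Sum>k\<in>UNIV. \<theta> k * of_int (A $ k $ j)"
    have mon: "mon_at (\<lambda>i. exp (?r $ i)) m = torus_char (?cls m) \<theta>" for m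
    proof -
      have "(\<Sum>i\<in>UNIV. of_nat (lookup m i) * ?r $ i) = (\<Sum>k\<in>UNIV. \<theta> k * of_int (?cls m $ k))"
        unfolding matrix_vector_mult_def expo_def
        by (simp add: sum_distrib_left, subst sum.swap) (simp add: mult_ac)
      then show ?thesis
        unfolding mon_at_exp torus_char_def by (rule arg_cong)
    qed
    have "0 = eval (\<lambda>i. exp (?r $ i)) f"
      using assms[OF row_space_intro, of \<theta>] by simp
    also have "\<dots> = (\<Sum>m\<in>keys f. lookup f m * torus_char (?cls m) \<theta>)"
      unfolding eval_eq_sum mon ..
    also have "\<dots> = (\<Sum>t\<in>?T. \<Sum>m\<in>?fib t. lookup f m * torus_char (?cls m) \<theta>)"
      by (rule sum.image_gen) simp
    also have "\<dots> = (\<Sum>t\<in>?T. (\<Sum>m\<in>?fib t. lookup f m) * torus_char t \<theta>)"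
      by (simp add: sum_distrib_right)
    finally show "(\<Sum>t\<in>?T. (\<Sum>m\<in>?fib t. lookup f m) * torus_char t \<theta>) = 0"
      by simp
  qed (use that in auto)
  have "(\<Sum>m\<in>?fib t. Const (lookup f m) * monomial m) \<in> toric_ideal A" if t: "t \<in> ?T" for t
  proof -
    obtain m0 where m0: "t = ?cls m0"
      using t by blast
    have "(\<Sum>m\<in>?fib t. Const (lookup f m) * monomial m)
        = (\<Sum>m\<in>?fib t. Const (lookup f m) * (monomial m - monomial m0)) +
          Const (\<Sum>m\<in>?fib t. lookup f m) * monomial m0"
      by (simp add: Const_sum sum_distrib_right right_diff_distrib sum_subtractf)
    also have "\<dots> = (\<Sum>m\<in>?fib t. Const (lookup f m) * (monomial m - monomial m0))"
      by (simp add: coef[OF t] Const_def)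
    also have "\<dots> \<in> toric_ideal A"
      using toric_ideal_base m0 unfolding toric_ideal_def
      by (intro ideal_gen_sum ideal_gen_mult) (simp add: toric_ideal_base[unfolded toric_ideal_def])
    finally show ?thesis .
  qed
  then have "(\<Sum>t\<in>?T. \<Sum>m\<in>?fib t. Const (lookup f m) * monomial m) \<in> toric_ideal A"
    unfolding toric_ideal_def by (rule ideal_gen_sum)
  moreover have "f = (\<Sum>t\<in>?T. \<Sum>m\<in>?fib t. Const (lookup f m) * monomial m)"
    by (subst poly_eq_sum_Const) (simp add: monomial_eq_mon_at sum.image_gen[of "keys f" _ ?cls])
  ultimately show ?thesis
    by simp
qed

text \<open>The polynomials in \<open>p\<close> and \<open>u\<close> form the toric situation of the block matrix of \<open>A\<close> and the
  identity.\<close>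

definition block_matrix :: "int^'n::finite^'m::finite \<Rightarrow> int^('n + 'n)^('m + 'n)" where
  "block_matrix A = (\<chi> k j. case k of
      Inl k \<Rightarrow> (case j of Inl j \<Rightarrow> A $ k $ j | Inr _ \<Rightarrow> 0)
    | Inr i \<Rightarrow> (case j of Inl _ \<Rightarrow> 0 | Inr j \<Rightarrow> if i = j then 1 else 0))"

lemma mon_at_Plus:
  "mon_at x m = (\<Prod>i\<in>UNIV. x (Inl i) ^ lookup m (Inl i)) * (\<Prod>i\<in>UNIV. x (Inr i) ^ lookup m (Inr i))"
  unfolding mon_at_def by (rule prod_UNIV_Plus)

lemma incl_p_binomial: "incl_p (monomial v - monomial w) = mon_at pvar v - mon_at pvar w"
proof (cases "v = w")
  case True
  then show ?thesis
    by (simp add: incl_p_def poly_subst_def)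
next
  case False
  have "keys (monomial v - monomial w) \<subseteq> {v, w}"
    by (auto simp: in_keys_iff lookup_minus monomial_def lookup_single when_def split: if_splits)
  then show ?thesis
    unfolding incl_p_def using False
    by (subst poly_subst_superset[of "{v, w}"])
       (auto simp: lookup_minus monomial_def lookup_single when_def Const_def single_uminus)
qed

lemma toric_ideal_block_matrix_subset:
  fixes A :: "int^'n::finite^'m::finite"
  shows "toric_ideal (block_matrix A) \<subseteq> ideal_gen (incl_p ` toric_ideal A)"
  unfolding toric_ideal_def[of "block_matrix A"]
proof (rule ideal_gen_subset, clarify)
  fix v w :: "('n + 'n) \<Rightarrow>\<^sub>0 nat"
  assume vw: "block_matrix A *v expo v = block_matrix A *v expo w"
  define L where "L m = Poly_Mapping.Abs_poly_mapping (\<lambda>i. lookup m (Inl i))" for m :: "('n + 'n) \<Rightarrow>\<^sub>0 nat"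
  have L: "lookup (L m) i = lookup m (Inl i)" for m i
    by (simp add: L_def lookup_Abs_poly_mapping)
  have Inl: "(block_matrix A *v expo m) $ Inl k = (A *v expo (L m)) $ k" for m k
    by (simp add: block_matrix_def matrix_vector_mult_def expo_def L sum_UNIV_Plus)
  have Inr: "(block_matrix A *v expo m) $ Inr i = int (lookup m (Inr i))" for m i
    by (simp add: block_matrix_def matrix_vector_mult_def expo_def sum_UNIV_Plus
        if_distrib[of "\<lambda>z. z * _"] cong: if_cong)
  have "A *v expo (L v) = A *v expo (L w)"
    using vw Inl[of v] Inl[of w] by (metis vec_eq_iff)
  then have "incl_p (monomial (L v) - monomial (L w)) \<in> ideal_gen (incl_p ` toric_ideal A)"
    by (intro ideal_gen_base imageI toric_ideal_base)
  moreover have "lookup v (Inr i) = lookup w (Inr i)" for i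
    using Inr[of v i] Inr[of w i] vw by simp
  moreover have "monomial m = (\<Prod>i\<in>UNIV. uvar i ^ lookup m (Inr i)) * mon_at pvar (L m)" for m
    by (simp add: monomial_eq_mon_at mon_at_Plus mon_at_def L pvar_def uvar_def mult.commute)
  ultimately show "monomial v - monomial w \<in> ideal_gen (incl_p ` toric_ideal A)"
    by (simp add: incl_p_binomial ideal_gen_mult flip: right_diff_distrib)
qed

lemma extended_toric_ideal_if_vanishing:
  fixes A :: "int^'n::finite^'m::finite"
  assumes "\<And>r z. r \<in> row_space A \<Longrightarrow> eval (case_sum (\<lambda>i. exp (r $ i)) (\<lambda>i. exp (z i))) f = 0"
  shows "f \<in> ideal_gen (incl_p ` toric_ideal A)"
proof (rule subsetD[OF toric_ideal_block_matrix_subset], rule toric_ideal_if_vanishing_on_torus)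
  fix r assume "r \<in> row_space (block_matrix A)"
  then obtain \<theta> where \<theta>: "r = (\<chi> j. \<Sum>k\<in>UNIV. \<theta> k * of_int (block_matrix A $ k $ j))"
    by (auto simp: row_space_def)
  have "(\<chi> j. r $ Inl j) = (\<chi> j. \<Sum>k\<in>UNIV. \<theta> (Inl k) * of_int (A $ k $ j))"
    by (simp add: \<theta> sum_UNIV_Plus block_matrix_def)
  then have "(\<chi> j. r $ Inl j) \<in> row_space A"
    by (simp only: row_space_intro)
  from assms[OF this, of "\<lambda>j. r $ Inr j"]
  have "eval (case_sum (\<lambda>i. exp (r $ Inl i)) (\<lambda>i. exp (r $ Inr i))) f = 0"
    by simp
  moreover have "case_sum (\<lambda>i. exp (r $ Inl i)) (\<lambda>i. exp (r $ Inr i)) = (\<lambda>i. exp (r $ i))"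
    by (simp add: fun_eq_iff split: sum.split)
  ultimately show "eval (\<lambda>i. exp (r $ i)) f = 0"
    by simp
qed

section \<open>The likelihood correspondence of the toric model\<close>

definition likelihood_points :: "'n::finite proj set \<Rightarrow> ('n proj \<times> 'n proj) set" where
  "likelihood_points Z = {(proj_class p, proj_class u) | p u.
     p \<noteq> 0 \<and> u \<noteq> 0 \<and> proj_class p \<in> smooth_locus Z - hyperplanes \<and>
     (\<forall>t\<in>cone_tangent Z p. dlog_lik u p t = 0)}"

lemma likelihood_ideal_eq: "likelihood_ideal Z = vanishing_ideal2 (likelihood_points Z)"
  unfolding likelihood_ideal_def likelihood_correspondence_def likelihood_points_def[symmetric]
  by (rule vanishing_ideal2_hull)

lemma not_in_hyperplanes_iff:
  "x \<noteq> 0 \<Longrightarrow> proj_class x \<notin> hyperplanes \<longleftrightarrow> (\<forall>i. x $ i \<noteq> 0) \<and> (\<Sum>i\<in>UNIV. x $ i) \<noteq> 0"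
  by (auto simp: hyperplanes_def zero_locus_def vanishes_proj_class simp flip: sum_distrib_left
      dest: spec[of _ 1])

lemma dlog_lik_toric_zero:
  fixes A :: "int^'n::finite^'m::finite"
  assumes hom: "homogeneous_ideal (toric_ideal A)"
    and x: "toric_point A (\<lambda>i. x $ i)" "\<And>i. x $ i \<noteq> 0" "(\<Sum>i\<in>UNIV. x $ i) \<noteq> 0"
    and z: "\<And>k. (\<Sum>i\<in>UNIV. of_int (A $ k $ i) * z $ i) = s * (\<Sum>i\<in>UNIV. of_int (A $ k $ i) * x $ i)"
    and t: "t \<in> cone_tangent (toric_model A) x"
  shows "dlog_lik z x t = 0"
proof -
  have perp: "(\<Sum>i\<in>UNIV. (z $ i - s * x $ i) * r $ i) = 0" if "r \<in> row_space A" for r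
  proof (rule row_space_perp[OF that])
    show "(\<Sum>i\<in>UNIV. of_int (A $ k $ i) * (z $ i - s * x $ i)) = 0" for k
      using z[of k] by (simp add: right_diff_distrib sum_subtractf sum_distrib_left mult.left_commute)
  qed
  have "(\<Sum>i\<in>UNIV. z $ i) = s * (\<Sum>i\<in>UNIV. x $ i)"
    using perp[OF one_in_row_space[OF hom]] by (simp add: sum_subtractf sum_distrib_left)
  then have s: "(\<Sum>i\<in>UNIV. z $ i) / (\<Sum>i\<in>UNIV. x $ i) = s"
    using x(3) by simp
  obtain r where r: "r \<in> row_space A" "t = (\<chi> i. x $ i * r $ i)"
    using t unfolding cone_tangent_toric_model[OF hom x(1,2)] by blast
  have "dlog_lik z x t = (\<Sum>i\<in>UNIV. (z $ i - s * x $ i) * r $ i)"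
    unfolding dlog_lik_def s using x(2) by (intro sum.cong) (auto simp: r(2) field_simps)
  then show ?thesis
    using perp[OF r(1)] by simp
qed

lemma dlog_lik_toric_zeroD:
  fixes A :: "int^'n::finite^'m::finite"
  assumes hom: "homogeneous_ideal (toric_ideal A)"
    and x: "toric_point A (\<lambda>i. x $ i)" "\<And>i. x $ i \<noteq> 0"
    and zero: "\<forall>t\<in>cone_tangent (toric_model A) x. dlog_lik y x t = 0"
  shows "(\<Sum>i\<in>UNIV. of_int (A $ k $ i) * y $ i) =
    (\<Sum>i\<in>UNIV. y $ i) / (\<Sum>i\<in>UNIV. x $ i) * (\<Sum>i\<in>UNIV. of_int (A $ k $ i) * x $ i)"
proof -
  let ?s = "(\<Sum>i\<in>UNIV. y $ i) / (\<Sum>i\<in>UNIV. x $ i)"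
  have "(\<chi> j. of_int (A $ k $ j)) \<in> row_space A"
    unfolding row_space_eq_span by (rule vec.span_base) blast
  then have "(\<chi> i. x $ i * of_int (A $ k $ i)) \<in> cone_tangent (toric_model A) x"
    unfolding cone_tangent_toric_model[OF hom x] by force
  then have "dlog_lik y x (\<chi> i. x $ i * of_int (A $ k $ i)) = 0"
    using zero by blast
  then have "0 = (\<Sum>i\<in>UNIV. (y $ i / x $ i - ?s) * (x $ i * of_int (A $ k $ i)))"
    by (simp add: dlog_lik_def)
  also have "\<dots> = (\<Sum>i\<in>UNIV. of_int (A $ k $ i) * y $ i - ?s * (of_int (A $ k $ i) * x $ i))"
    using x(2) by (intro sum.cong) (auto simp: left_diff_distrib)
  finally show ?thesis
    by (simp add: sum_subtractf sum_distrib_left)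
qed

lemma likelihood_ideal_vanishes:
  fixes A :: "int^'n::finite^'m::finite"
  assumes hom: "homogeneous_ideal (toric_ideal A)" and f: "f \<in> likelihood_ideal (toric_model A)"
    and x: "toric_point A (\<lambda>i. x $ i)" "\<And>i. x $ i \<noteq> 0" "(\<Sum>i\<in>UNIV. x $ i) \<noteq> 0"
    and z: "\<And>k. (\<Sum>i\<in>UNIV. of_int (A $ k $ i) * z $ i) = s * (\<Sum>i\<in>UNIV. of_int (A $ k $ i) * x $ i)"
  shows "eval (case_sum (\<lambda>i. x $ i) (\<lambda>i. z $ i)) f = 0"
proof -
  have x0: "x \<noteq> 0"
    using x(2) by (auto simp: vec_eq_iff)
  have nz: "eval (case_sum (\<lambda>i. x $ i) (\<lambda>i. y $ i)) f = 0"
    if "y \<noteq> 0" and y: "\<And>k. (\<Sum>i\<in>UNIV. of_int (A $ k $ i) * y $ i) = s * (\<Sum>i\<in>UNIV. of_int (A $ k $ i) * x $ i)"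
    for y s
  proof -
    have "(proj_class x, proj_class y) \<in> likelihood_points (toric_model A)"
      unfolding likelihood_points_def
      using x0 that(1) torus_point_smooth[OF hom x(1,2)] not_in_hyperplanes_iff[OF x0] x(2,3)
        dlog_lik_toric_zero[OF hom x y] by blast
    then have "vanishes2 f (proj_class x, proj_class y)"
      using f unfolding likelihood_ideal_eq vanishing_ideal2_def by blast
    then have "eval (case_sum (\<lambda>i. 1 * x $ i) (\<lambda>i. 1 * y $ i)) f = 0"
      unfolding vanishes2_proj_class[OF x0 \<open>y \<noteq> 0\<close>] using zero_neq_one by metis
    then show ?thesis
      by simp
  qed
  show ?thesis
  proof (cases "z = 0")
    case False
    then show ?thesis
      using z by (rule nz)
  next
    case True
    show ?thesis
    proof (rule eval_zero_limit[where b = "case_sum (\<lambda>_. 0) (\<lambda>i. x $ i)"])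
      fix c :: complex assume c: "c \<noteq> 0"
      have "c *s x \<noteq> 0"
        using c x0 by simp
      then have "eval (case_sum (\<lambda>i. x $ i) (\<lambda>i. (c *s x) $ i)) f = 0"
        by (rule nz[where s = c]) (simp add: sum_distrib_left mult.left_commute)
      moreover have "case_sum (\<lambda>i. x $ i) (\<lambda>i. (c *s x) $ i) =
          (\<lambda>i. case_sum (\<lambda>i. x $ i) (\<lambda>i. z $ i) i + c * case_sum (\<lambda>_. 0) (\<lambda>i. x $ i) i)"
        by (auto simp: fun_eq_iff True split: sum.split)
      ultimately show "eval (\<lambda>i. case_sum (\<lambda>i. x $ i) (\<lambda>i. z $ i) i + c * case_sum (\<lambda>_. 0) (\<lambda>i. x $ i) i) f = 0"
        by simp
    qed
  qed
qed

section \<open>The ideal of minors\<close>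

abbreviation p_plus :: "('n::finite + 'n) cpoly" where "p_plus \<equiv> sum pvar UNIV"
abbreviation u_plus :: "('n::finite + 'n) cpoly" where "u_plus \<equiv> sum uvar UNIV"

definition likelihood_equations :: "int^'n::finite^'m::finite \<Rightarrow> ('n + 'n) cpoly set" where
  "likelihood_equations A =
     ideal_sum (ideal_gen (incl_p ` toric_ideal A)) (minors_ideal TYPE(2) (matrix_AM A))"

definition row_p :: "int^'n::finite^'m::finite \<Rightarrow> 'm \<Rightarrow> ('n + 'n) cpoly" where
  "row_p A k = (\<Sum>i\<in>UNIV. of_int (A $ k $ i) * pvar i)"

definition row_u :: "int^'n::finite^'m::finite \<Rightarrow> 'm \<Rightarrow> ('n + 'n) cpoly" where
  "row_u A k = (\<Sum>i\<in>UNIV. of_int (A $ k $ i) * uvar i)"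

lemma matrix_AM_nth: "matrix_AM A $ k $ c = (if c = 1 then row_u A k else row_p A k)"
  using exhaust_2[of c]
  by (auto simp: matrix_AM_def matrix_M_def matrix_matrix_mult_def row_p_def row_u_def)

lemma
  fixes x y :: "'n::finite \<Rightarrow> complex"
  shows eval_pvar [simp]: "eval (case_sum x y) (pvar i) = x i"
    and eval_uvar [simp]: "eval (case_sum x y) (uvar i) = y i"
  by (simp_all add: pvar_def uvar_def)

lemma eval_incl_p:
  fixes x y :: "'n::finite \<Rightarrow> complex"
  shows "eval (case_sum x y) (incl_p f) = eval x f"
proof -
  have "Const 0 = (0 :: ('n + 'n) cpoly)"
    by (simp add: Const_def)
  then show ?thesis
    by (simp add: incl_p_def poly_subst_superset[of "keys f" f Const] eval_eq_sum[of x f])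
qed

lemma likelihood_equations_eq_ideal_gen:
  "likelihood_equations A = ideal_gen (incl_p ` toric_ideal A \<union>
     {det ((\<chi> a b. matrix_AM A $ r a $ c b) :: ('n::finite + 'n) cpoly^2^2) | r c. inj r \<and> inj c})"
  unfolding likelihood_equations_def minors_ideal_def ideal_sum_def ideal_gen_def
  by (rule module.span_Un[OF module_mult, symmetric])

lemma toric_extension_subset: "ideal_gen (incl_p ` toric_ideal A) \<subseteq> likelihood_equations A"
  unfolding likelihood_equations_eq_ideal_gen
  by (rule ideal_gen_subset) (auto intro: ideal_gen_base)

lemma minor_in_likelihood_equations:
  fixes A :: "int^'n::finite^'m::finite"
  shows "row_u A k * row_p A l - row_p A k * row_u A l \<in> likelihood_equations A"
proof (cases "k = l")
  case True
  then show ?thesis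
    by (simp add: likelihood_equations_eq_ideal_gen mult.commute)
next
  case False
  define r where "r a = (if a = 1 then k else l)" for a :: 2
  have "inj r"
    using False exhaust_2 unfolding inj_def r_def by metis
  moreover have "det ((\<chi> a b. matrix_AM A $ r a $ id b) :: ('n + 'n) cpoly^2^2)
      = row_u A k * row_p A l - row_p A k * row_u A l"
    by (simp add: det_2 matrix_AM_nth r_def)
  ultimately show ?thesis
    unfolding likelihood_equations_eq_ideal_gen
    by (intro ideal_gen_base UnI2 CollectI exI[of _ r] exI[of _ id]) simp
qed

lemma likelihood_equations_vanish:
  fixes A :: "int^'n::finite^'m::finite"
  assumes "f \<in> likelihood_equations A" "toric_point A x"
    and y: "\<And>k. (\<Sum>i\<in>UNIV. of_int (A $ k $ i) * y i) = s * (\<Sum>i\<in>UNIV. of_int (A $ k $ i) * x i)"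
  shows "eval (case_sum x y) f = 0"
  using assms(1) unfolding likelihood_equations_eq_ideal_gen
proof (rule eval_ideal_gen_zero)
  fix g assume "g \<in> incl_p ` toric_ideal A \<union>
     {det ((\<chi> a b. matrix_AM A $ r a $ c b) :: ('n + 'n) cpoly^2^2) | r c. inj r \<and> inj c}"
  then consider h where "h \<in> toric_ideal A" "g = incl_p h"
    | r c where "g = det ((\<chi> a b. matrix_AM A $ r a $ c b) :: ('n + 'n) cpoly^2^2)"
    by blast
  then show "eval (case_sum x y) g = 0"
  proof cases
    case 1
    then show ?thesis
      using eval_toric_ideal[OF assms(2)] by (simp add: eval_incl_p)
  next
    case 2
    have "eval (case_sum x y) (matrix_AM A $ k $ d) =
        (if d = 1 then s else 1) * (\<Sum>i\<in>UNIV. of_int (A $ k $ i) * x i)" for k d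
      by (simp add: matrix_AM_nth row_u_def row_p_def y)
    then show ?thesis
      by (simp add: 2 det_2)
  qed
qed

lemma dehomogenized_mult:
  fixes q :: "'r::comm_ring_1"
  assumes "(\<Sum>i\<in>UNIV. n i) \<le> N"
  shows "q ^ (N - (\<Sum>i\<in>UNIV. n i)) * (\<Prod>i\<in>UNIV. (q * z i) ^ n i) = q ^ N * (\<Prod>i\<in>(UNIV::'i::finite set). z i ^ n i)"
proof -
  have "(\<Prod>i\<in>UNIV. (q * z i) ^ n i) = q ^ (\<Sum>i\<in>UNIV. n i) * (\<Prod>i\<in>UNIV. z i ^ n i)"
    by (simp add: power_mult_distrib prod.distrib power_sum)
  then show ?thesis
    using assms by (simp add: mult.assoc[symmetric] flip: power_add)
qed

definition u_degree :: "(('n::finite + 'n) \<Rightarrow>\<^sub>0 nat) \<Rightarrow> nat" where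
  "u_degree m = (\<Sum>i\<in>UNIV. lookup m (Inr i))"

text \<open>This is \<open>q\<^sup>N f(p, w / q)\<close>, but only if \<open>N\<close> bounds the degree of \<open>f\<close> in \<open>u\<close>: the subtraction
  truncates.\<close>

definition subst_u :: "nat \<Rightarrow> ('n::finite + 'n) cpoly \<Rightarrow> ('n \<Rightarrow> ('n + 'n) cpoly) \<Rightarrow> ('n + 'n) cpoly \<Rightarrow> ('n + 'n) cpoly" where
  "subst_u N q w f = (\<Sum>m\<in>keys f. Const (lookup f m) * (\<Prod>i\<in>UNIV. pvar i ^ lookup m (Inl i)) *
     (q ^ (N - u_degree m) * (\<Prod>i\<in>UNIV. w i ^ lookup m (Inr i))))"

lemma subst_u_self:
  assumes "\<And>m. m \<in> keys f \<Longrightarrow> u_degree m \<le> N"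
  shows "subst_u N q (\<lambda>i. q * uvar i) f = q ^ N * f"
proof -
  have "subst_u N q (\<lambda>i. q * uvar i) f = (\<Sum>m\<in>keys f. q ^ N * (Const (lookup f m) * mon_at Var m))"
    unfolding subst_u_def
  proof (rule sum.cong[OF refl])
    fix m assume "m \<in> keys f"
    then show "Const (lookup f m) * (\<Prod>i\<in>UNIV. pvar i ^ lookup m (Inl i)) *
        (q ^ (N - u_degree m) * (\<Prod>i\<in>UNIV. (q * uvar i) ^ lookup m (Inr i)))
        = q ^ N * (Const (lookup f m) * mon_at Var m)"
      using dehomogenized_mult[of "\<lambda>i. lookup m (Inr i)" N q uvar] assms[of m]
      by (simp add: u_degree_def mon_at_Plus pvar_def uvar_def mult_ac)
  qed
  then show ?thesis
    by (simp add: poly_eq_sum_Const[of f, symmetric] flip: sum_distrib_left)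
qed

lemma eval_subst_u:
  fixes x y :: "'n::finite \<Rightarrow> complex"
  assumes "\<And>m. m \<in> keys f \<Longrightarrow> u_degree m \<le> N"
    and "\<And>i. eval (case_sum x y) (w i) = eval (case_sum x y) q * z i"
  shows "eval (case_sum x y) (subst_u N q w f) = eval (case_sum x y) q ^ N * eval (case_sum x z) f"
proof -
  let ?q = "eval (case_sum x y) q"
  have "eval (case_sum x y) (subst_u N q w f) = (\<Sum>m\<in>keys f. ?q ^ N * (lookup f m * mon_at (case_sum x z) m))"
    unfolding subst_u_def eval_sum
  proof (rule sum.cong[OF refl])
    fix m assume "m \<in> keys f"
    then show "eval (case_sum x y) (Const (lookup f m) * (\<Prod>i\<in>UNIV. pvar i ^ lookup m (Inl i)) *
        (q ^ (N - u_degree m) * (\<Prod>i\<in>UNIV. w i ^ lookup m (Inr i))))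
        = ?q ^ N * (lookup f m * mon_at (case_sum x z) m)"
      using dehomogenized_mult[of "\<lambda>i. lookup m (Inr i)" N ?q z] assms(1)[of m]
      by (simp add: u_degree_def mon_at_Plus assms(2) mult_ac)
  qed
  then show ?thesis
    by (simp add: eval_eq_sum[of "case_sum x z"] sum_distrib_left)
qed

lemma ideal_gen_prod_cong:
  assumes "\<And>i. i \<in> I \<Longrightarrow> a i - b i \<in> ideal_gen S"
  shows "(\<Prod>i\<in>I. a i) - (\<Prod>i\<in>I. b i) \<in> ideal_gen S"
  using assms
proof (induction I rule: infinite_finite_induct)
  case (insert i I)
  have "(\<Prod>j\<in>insert i I. a j) - (\<Prod>j\<in>insert i I. b j)
      = (\<Prod>j\<in>I. a j) * (a i - b i) + b i * ((\<Prod>j\<in>I. a j) - (\<Prod>j\<in>I. b j))"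
    using insert.hyps by (simp add: algebra_simps)
  then show ?case
    using insert by (simp add: ideal_gen_add ideal_gen_mult)
qed auto

lemma subst_u_cong:
  assumes "\<And>i. w i - w' i \<in> ideal_gen S"
  shows "subst_u N q w f - subst_u N q w' f \<in> ideal_gen S"
proof -
  have pow: "w i ^ k - w' i ^ k \<in> ideal_gen S" for i k
    using ideal_gen_prod_cong[of "{..<k}" "\<lambda>_. w i" "\<lambda>_. w' i" S] assms by simp
  have "(\<Prod>i\<in>UNIV. w i ^ lookup m (Inr i)) - (\<Prod>i\<in>UNIV. w' i ^ lookup m (Inr i)) \<in> ideal_gen S" for m
    by (rule ideal_gen_prod_cong) (rule pow)
  then show ?thesis
    unfolding subst_u_def sum_subtractf[symmetric] right_diff_distrib[symmetric]
    by (intro ideal_gen_sum ideal_gen_mult)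
qed

text \<open>Modulo the minors, \<open>D p\<^sub>+ u\<close> agrees with a vector \<open>w\<close> all of whose values satisfy the
  likelihood equations; it arises by projecting \<open>u - (u\<^sub>+ / p\<^sub>+) p\<close> to the kernel of \<open>A\<close>.\<close>

lemma projected_data:
  fixes A :: "int^'n::finite^'m::finite"
  assumes hom: "homogeneous_ideal (toric_ideal A)"
  obtains D :: int and w :: "'n \<Rightarrow> ('n + 'n) cpoly" where "D > 0"
    "\<And>i. w i - of_int D * p_plus * uvar i \<in> likelihood_equations A"
    "\<And>(x :: 'n \<Rightarrow> complex) y k. (\<Sum>i\<in>UNIV. of_int (A $ k $ i) * eval (case_sum x y) (w i)) =
       of_int D * (\<Sum>i\<in>UNIV. y i) * (\<Sum>i\<in>UNIV. of_int (A $ k $ i) * x i)"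
proof -
  obtain c where c: "(1 :: complex^'n) = (\<chi> j. \<Sum>k\<in>UNIV. c k * of_int (A $ k $ j))"
    using one_in_row_space[OF hom] by (auto simp: row_space_def)
  have c1: "(\<Sum>k\<in>UNIV. c k * of_int (A $ k $ j)) = 1" for j
    using arg_cong[OF c, of "\<lambda>v. v $ j"] by simp
  have combine: "(\<Sum>l\<in>UNIV. Const (c l) * (\<Sum>i\<in>UNIV. of_int (A $ l $ i) * v i)) = (\<Sum>i\<in>UNIV. v i)"
    for v :: "'n \<Rightarrow> ('n + 'n) cpoly"
  proof -
    have "(\<Sum>l\<in>UNIV. Const (c l) * (\<Sum>i\<in>UNIV. of_int (A $ l $ i) * v i))
        = (\<Sum>i\<in>UNIV. Const (\<Sum>l\<in>UNIV. c l * of_int (A $ l $ i)) * v i)"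
      unfolding Const_sum Const_mult Const_of_int sum_distrib_left sum_distrib_right
      by (subst sum.swap) (simp add: mult.assoc)
    then show ?thesis
      by (simp add: c1)
  qed
  define E where "E k = p_plus * row_u A k - u_plus * row_p A k" for k
  have E: "E k \<in> likelihood_equations A" for k
  proof -
    have "E k = (\<Sum>l\<in>UNIV. Const (c l) * (row_u A k * row_p A l - row_p A k * row_u A l))"
      unfolding E_def combine[of pvar, symmetric] combine[of uvar, symmetric]
        row_p_def[symmetric] row_u_def[symmetric]
      by (simp add: sum_distrib_left sum_distrib_right right_diff_distrib sum_subtractf mult_ac)
    then show ?thesis
      using minor_in_likelihood_equations[of A]
      by (simp add: likelihood_equations_eq_ideal_gen ideal_gen_sum ideal_gen_mult)
  qed
  obtain R :: "int^'m^'n" and D where RD: "D > 0"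
    "\<And>k j. (\<Sum>i\<in>UNIV. A $ k $ i * (\<Sum>l\<in>UNIV. R $ i $ l * A $ l $ j)) = D * A $ k $ j"
    using integral_generalized_inverse by blast
  define w where "w i = of_int D * p_plus * uvar i - (\<Sum>l\<in>UNIV. of_int (R $ i $ l) * E l)" for i
  show ?thesis
  proof (rule that[OF RD(1)])
    fix i
    have "w i - of_int D * p_plus * uvar i = (\<Sum>l\<in>UNIV. (- of_int (R $ i $ l)) * E l)"
      by (simp add: w_def sum_negf)
    also have "\<dots> \<in> likelihood_equations A"
      using E unfolding likelihood_equations_eq_ideal_gen by (intro ideal_gen_sum ideal_gen_mult)
    finally show "w i - of_int D * p_plus * uvar i \<in> likelihood_equations A" .
  next
    fix x y :: "'n \<Rightarrow> complex" and k
    define xp yp where "xp = (\<Sum>i\<in>UNIV. x i)" and "yp = (\<Sum>i\<in>UNIV. y i)"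
    define v where "v j = xp * y j - yp * x j" for j
    have evalE: "eval (case_sum x y) (E l) = (\<Sum>j\<in>UNIV. of_int (A $ l $ j) * v j)" for l
    proof -
      have "eval (case_sum x y) (E l) =
          xp * (\<Sum>j\<in>UNIV. of_int (A $ l $ j) * y j) - yp * (\<Sum>j\<in>UNIV. of_int (A $ l $ j) * x j)"
        by (simp add: E_def row_u_def row_p_def xp_def yp_def)
      then show ?thesis
        by (simp add: v_def right_diff_distrib sum_subtractf sum_distrib_left mult.left_commute)
    qed
    define P where "P i j = (\<Sum>l\<in>UNIV. R $ i $ l * A $ l $ j)" for i j
    have "(\<Sum>l\<in>UNIV. of_int (R $ i $ l) * (\<Sum>j\<in>UNIV. of_int (A $ l $ j) * v j))
        = (\<Sum>j\<in>UNIV. of_int (P i j) * v j)" for i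
      unfolding sum_distrib_left P_def of_int_sum sum_distrib_right
      by (subst sum.swap) (simp add: mult.assoc)
    then have "(\<Sum>i\<in>UNIV. of_int (A $ k $ i) * (\<Sum>l\<in>UNIV. of_int (R $ i $ l) * (\<Sum>j\<in>UNIV. of_int (A $ l $ j) * v j)))
        = (\<Sum>i\<in>UNIV. \<Sum>j\<in>UNIV. of_int (A $ k $ i) * (of_int (P i j) * v j))"
      by (simp only: sum_distrib_left)
    also have "\<dots> = (\<Sum>j\<in>UNIV. of_int (\<Sum>i\<in>UNIV. A $ k $ i * P i j) * v j)"
      unfolding of_int_sum sum_distrib_right by (subst sum.swap) (simp add: mult.assoc)
    also have "\<dots> = of_int D * (\<Sum>j\<in>UNIV. of_int (A $ k $ j) * v j)"
      unfolding P_def RD(2) by (simp add: sum_distrib_left mult.assoc)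
    finally have ARA: "(\<Sum>i\<in>UNIV. of_int (A $ k $ i) * (\<Sum>l\<in>UNIV. of_int (R $ i $ l) * eval (case_sum x y) (E l)))
        = of_int D * (\<Sum>j\<in>UNIV. of_int (A $ k $ j) * v j)"
      unfolding evalE .
    have "(\<Sum>i\<in>UNIV. of_int (A $ k $ i) * eval (case_sum x y) (w i))
        = (\<Sum>i\<in>UNIV. of_int (A $ k $ i) * (of_int D * xp * y i))
          - of_int D * (\<Sum>j\<in>UNIV. of_int (A $ k $ j) * v j)"
      unfolding ARA[symmetric] by (simp add: w_def xp_def right_diff_distrib sum_subtractf)
    also have "\<dots> = (\<Sum>i\<in>UNIV. of_int D * yp * (of_int (A $ k $ i) * x i))"
      unfolding sum_distrib_left sum_subtractf[symmetric]
      by (rule sum.cong) (simp_all add: v_def algebra_simps)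
    finally show "(\<Sum>i\<in>UNIV. of_int (A $ k $ i) * eval (case_sum x y) (w i)) =
       of_int D * (\<Sum>i\<in>UNIV. y i) * (\<Sum>i\<in>UNIV. of_int (A $ k $ i) * x i)"
      by (simp only: yp_def sum_distrib_left)
  qed
qed

lemma p_plus_power_mult:
  fixes A :: "int^'n::finite^'m::finite"
  assumes hom: "homogeneous_ideal (toric_ideal A)" and f: "f \<in> likelihood_ideal (toric_model A)"
  obtains N where "p_plus ^ N * f \<in> likelihood_equations A"
proof -
  obtain D w where D: "D > 0" and w: "\<And>i. w i - of_int D * p_plus * uvar i \<in> likelihood_equations A"
    and Aw: "\<And>(x :: 'n \<Rightarrow> complex) y k. (\<Sum>i\<in>UNIV. of_int (A $ k $ i) * eval (case_sum x y) (w i)) =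
       of_int D * (\<Sum>i\<in>UNIV. y i) * (\<Sum>i\<in>UNIV. of_int (A $ k $ i) * x i)"
    using projected_data[OF hom] by blast
  let ?q = "of_int D * p_plus :: ('n + 'n) cpoly"
  define N where "N = Max (insert 0 (u_degree ` keys f))"
  have N: "u_degree m \<le> N" if "m \<in> keys f" for m
    unfolding N_def using that by (intro Max_ge) auto
  define g where "g = subst_u N ?q w f"
  have g: "g - ?q ^ N * f \<in> likelihood_equations A"
  proof -
    have "subst_u N ?q w f - subst_u N ?q (\<lambda>i. ?q * uvar i) f \<in> likelihood_equations A"
      using w unfolding likelihood_equations_eq_ideal_gen by (rule subst_u_cong)
    then show ?thesis
      by (simp only: g_def subst_u_self[OF N])
  qed
  have "p_plus * g \<in> ideal_gen (incl_p ` toric_ideal A)"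
  proof (rule extended_toric_ideal_if_vanishing)
    fix r :: "complex^'n" and \<eta> :: "'n \<Rightarrow> complex"
    assume r: "r \<in> row_space A"
    let ?x = "\<lambda>i. exp (r $ i)" and ?y = "\<lambda>i. exp (\<eta> i)"
    let ?xp = "\<Sum>i\<in>UNIV. ?x i"
    show "eval (case_sum ?x ?y) (p_plus * g) = 0"
    proof (cases "?xp = 0")
      case True
      then show ?thesis
        by simp
    next
      case False
      define z where "z = (\<chi> i. eval (case_sum ?x ?y) (w i) / (of_int D * ?xp))"
      have "eval (case_sum (\<lambda>i. (\<chi> i. ?x i) $ i) (\<lambda>i. z $ i)) f = 0"
      proof (rule likelihood_ideal_vanishes[OF hom f])
        show "toric_point A (\<lambda>i. (\<chi> i. ?x i) $ i)"
          using toric_point_exp[OF toric_point_one r] by simp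
        show "(\<Sum>i\<in>UNIV. of_int (A $ k $ i) * z $ i) =
            ((\<Sum>i\<in>UNIV. ?y i) / ?xp) * (\<Sum>i\<in>UNIV. of_int (A $ k $ i) * (\<chi> i. ?x i) $ i)" for k
        proof -
          have "(\<Sum>i\<in>UNIV. of_int (A $ k $ i) * z $ i) =
              (\<Sum>i\<in>UNIV. of_int (A $ k $ i) * eval (case_sum ?x ?y) (w i)) / (of_int D * ?xp)"
            by (simp add: z_def sum_divide_distrib)
          then show ?thesis
            using D by (simp add: Aw)
        qed
      qed (use False in simp_all)
      moreover have "eval (case_sum ?x ?y) (w i) = eval (case_sum ?x ?y) ?q * z $ i" for i
        using D False by (simp add: z_def)
      ultimately have "eval (case_sum ?x ?y) g = 0"
        unfolding g_def using eval_subst_u[OF N, of f ?x ?y w ?q "\<lambda>i. z $ i"] by simp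
      then show ?thesis
        by simp
    qed
  qed
  then have "p_plus * g \<in> likelihood_equations A"
    using toric_extension_subset by blast
  then have "Const (1 / of_int D ^ N) * (p_plus * g - p_plus * (g - ?q ^ N * f)) \<in> likelihood_equations A"
    using g unfolding likelihood_equations_eq_ideal_gen
    by (rule ideal_gen_mult[OF ideal_gen_diff[OF _ ideal_gen_mult]])
  moreover have "Const (1 / of_int D ^ N) * (of_int D ^ N) = (1 :: ('n + 'n) cpoly)"
  proof -
    have "(of_int D ^ N :: ('n + 'n) cpoly) = Const (of_int (D ^ N))"
      unfolding Const_of_int by (simp only: of_int_power)
    then show ?thesis
      using D by (simp flip: Const_mult)
  qed
  then have "Const (1 / of_int D ^ N) * (p_plus * g - p_plus * (g - ?q ^ N * f)) = p_plus ^ Suc N * f"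
    by (simp add: right_diff_distrib power_mult_distrib mult.assoc[symmetric])
       (simp add: mult_ac)
  ultimately have "p_plus ^ Suc N * f \<in> likelihood_equations A"
    by simp
  then show ?thesis
    by (rule that)
qed

section \<open>Saturation by a principal ideal\<close>

lemma saturation_principal_iff:
  fixes h :: "'r::comm_ring_1"
  shows "f \<in> saturation (ideal_gen S) (ideal_gen {h}) \<longleftrightarrow> (\<exists>N. h ^ N * f \<in> ideal_gen S)"
proof
  assume "f \<in> saturation (ideal_gen S) (ideal_gen {h})"
  then obtain N where N: "\<And>g. g \<in> ideal_pow (ideal_gen {h}) N \<Longrightarrow> f * g \<in> ideal_gen S"
    by (auto simp: saturation_def colon_def)
  have "(\<Prod>i<N. h) \<in> ideal_pow (ideal_gen {h}) N"
    unfolding ideal_pow_def by (rule ideal_gen_base) (blast intro: ideal_gen_base)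
  then have "f * h ^ N \<in> ideal_gen S"
    using N by simp
  then show "\<exists>N. h ^ N * f \<in> ideal_gen S"
    by (auto simp: mult.commute)
next
  assume "\<exists>N. h ^ N * f \<in> ideal_gen S"
  then obtain N where N: "h ^ N * f \<in> ideal_gen S"
    by blast
  have principal: "\<exists>c. g = c * h" if "g \<in> ideal_gen {h}" for g
    using that by (induction rule: ideal_gen_induct) (auto intro: exI[of _ 0] simp flip: distrib_right)
  have "f * g \<in> ideal_gen S" if "g \<in> ideal_pow (ideal_gen {h}) N" for g
    using that unfolding ideal_pow_def
  proof (induction rule: ideal_gen_induct)
    case (step c s y)
    then obtain a where a: "s = (\<Prod>i<N. a i)" "\<And>i. i < N \<Longrightarrow> a i \<in> ideal_gen {h}"
      by blast
    then obtain b where b: "\<And>i. i < N \<Longrightarrow> a i = b i * h"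
      using principal[OF a(2)] by metis
    have "s = (\<Prod>i<N. b i) * h ^ N"
      using b by (simp add: a(1) prod.distrib cong: prod.cong_simp)
    then have "f * (c * s + y) = (c * (\<Prod>i<N. b i)) * (h ^ N * f) + f * y"
      by (simp add: algebra_simps)
    then show ?case
      using step N by (simp add: ideal_gen_add ideal_gen_mult)
  qed simp
  then show "f \<in> saturation (ideal_gen S) (ideal_gen {h})"
    by (auto simp: saturation_def colon_def)
qed

theorem theorem3p1:
  fixes A :: "int^'n::finite^'m::finite"
  assumes "\<And>j k. (\<Sum>i\<in>UNIV. A $ i $ j) = (\<Sum>i\<in>UNIV. A $ i $ k)"
    and "homogeneous_ideal (toric_ideal A)"
  shows "saturation
           (ideal_sum (ideal_gen (incl_p ` toric_ideal A)) (minors_ideal TYPE(2) (matrix_AM A)))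
           (ideal_gen {(\<Prod>i\<in>UNIV. pvar i) * (\<Sum>i\<in>UNIV. pvar i)})
         = likelihood_ideal (toric_model A)"
proof -
  note hom = assms(2)
  let ?h = "(\<Prod>i\<in>UNIV. pvar i) * p_plus :: ('n + 'n) cpoly"
  have sat: "f \<in> saturation (likelihood_equations A) (ideal_gen {?h}) \<longleftrightarrow>
      (\<exists>N. ?h ^ N * f \<in> likelihood_equations A)" for f
    unfolding likelihood_equations_eq_ideal_gen by (rule saturation_principal_iff)
  have "saturation (likelihood_equations A) (ideal_gen {?h}) = likelihood_ideal (toric_model A)"
  proof (intro equalityI subsetI)
    fix f assume "f \<in> saturation (likelihood_equations A) (ideal_gen {?h})"
    then obtain N where N: "?h ^ N * f \<in> likelihood_equations A"
      using sat by blast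
    have "vanishes2 f (proj_class x, proj_class y)"
      if "x \<noteq> 0" "y \<noteq> 0" and smooth: "proj_class x \<in> smooth_locus (toric_model A) - hyperplanes"
        and zero: "\<forall>t\<in>cone_tangent (toric_model A) x. dlog_lik y x t = 0" for x y
      unfolding vanishes2_proj_class[OF that(1,2)]
    proof (intro allI impI)
      fix a b :: complex assume ab: "a \<noteq> 0" "b \<noteq> 0"
      have x: "\<And>i. x $ i \<noteq> 0" "(\<Sum>i\<in>UNIV. x $ i) \<noteq> 0"
        using smooth not_in_hyperplanes_iff[OF \<open>x \<noteq> 0\<close>] by auto
      have "toric_point A (\<lambda>i. x $ i)"
        using smooth toric_model_iff[OF hom \<open>x \<noteq> 0\<close>] by (simp add: smooth_locus_def)
      note Ay = dlog_lik_toric_zeroD[OF hom this x(1) zero] and ax = toric_point_scale[OF hom this, of a]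
      have "(\<Sum>i\<in>UNIV. of_int (A $ k $ i) * (b * y $ i)) =
          (b * ((\<Sum>i\<in>UNIV. y $ i) / (\<Sum>i\<in>UNIV. x $ i)) / a) * (\<Sum>i\<in>UNIV. of_int (A $ k $ i) * (a * x $ i))" for k
        using Ay[of k] ab by (simp add: mult.left_commute flip: sum_distrib_left)
      then have "eval (case_sum (\<lambda>i. a * x $ i) (\<lambda>i. b * y $ i)) (?h ^ N * f) = 0"
        by (rule likelihood_equations_vanish[OF N ax])
      moreover have "eval (case_sum (\<lambda>i. a * x $ i) (\<lambda>i. b * y $ i)) ?h \<noteq> 0"
        using x ab by (simp flip: sum_distrib_left)
      ultimately show "eval (case_sum (\<lambda>i. a * x $ i) (\<lambda>i. b * y $ i)) f = 0"
        by (simp del: eval_sum eval_prod)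
    qed
    then show "f \<in> likelihood_ideal (toric_model A)"
      unfolding likelihood_ideal_eq vanishing_ideal2_def likelihood_points_def by blast
  next
    fix f assume "f \<in> likelihood_ideal (toric_model A)"
    then obtain N where "p_plus ^ N * f \<in> likelihood_equations A"
      using p_plus_power_mult[OF hom] by blast
    then have "(\<Prod>i\<in>UNIV. pvar i) ^ N * (p_plus ^ N * f) \<in> likelihood_equations A"
      unfolding likelihood_equations_eq_ideal_gen by (rule ideal_gen_mult)
    then show "f \<in> saturation (likelihood_equations A) (ideal_gen {?h})"
      unfolding sat by (auto simp: power_mult_distrib mult.assoc)
  qed
  then show ?thesis
    unfolding likelihood_equations_def .
qed

end
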